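(* Let $n\geq 1$ be an integer and let $(a_k)_{k=1}^{i}$ and $(b_k)_{k=1}^{i}$ be finite sequences with $a_k,b_k\in\mathbb{C}\setminus\mathbb{Z}_{<0}$ such that $\sum_{k=1}^{i}a_k^{j}=\sum_{k=1}^{i}b_k^{j}$ for every $j\in\{1,2,\dots,n\}$. Then $$\prod_{k=1}^{\infty}\left[\frac{(k+a_1)\cdots(k+a_i)}{(k+b_1)\cdots(k+b_i)}\right]^{\binom{n+k-2}{n-1}}=\frac{\Gamma_n(b_1+1)\cdots\Gamma_n(b_i+1)}{\Gamma_n(a_1+1)\cdots\Gamma_n(a_i+1)},$$ where $\Gamma_n$ is the Multiple Gamma Function of order $n$.
   Context: The Multiple Gamma Functions $\Gamma_n$ ($n\ge 1$) are the meromorphic functions on $\mathbb{C}$ determined by $\Gamma_1=\Gamma$ (the Euler Gamma function), $\Gamma_n(1)=1$, the functional equation $\Gamma_{n+1}(z+1)=\Gamma_{n+1}(z)/\Gamma_n(z)$, and the log-convexity property that $\Gamma_n$ is positive on $(0,\infty)$ with $(-1)^{n+1}\frac{d^{n+1}}{dx^{n+1}}\log\Gamma_n(x)\ge 0$ for all real $x>0$. In particular $\Gamma_2(z)=1/G(z)$, where $G$ is the Barnes G-function. $\mathbb{Z}_{<0}$ denotes the negative integers. The infinite product is the limit of its partial products. *)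

theory Defs
  imports "HOL-Complex_Analysis.Complex_Analysis"
begin

text \<open>
  A meromorphic function is represented by its normalised version: it takes the value 0 at its
  poles, as \<^const>\<open>Gamma\<close> does, and has no removable singularities. The functional
  equation is an identity between meromorphic functions and hence only required away from a sparse
  set: at 0, for instance, both functions on its right-hand side have poles, so that the quotient of
  their values is 0 there, whereas the left-hand side is 1.
  The entry at index 0 is irrelevant.
\<close>

definition multiple_Gamma_family :: "(nat \<Rightarrow> complex \<Rightarrow> complex) \<Rightarrow> bool" where
  "multiple_Gamma_family G \<longleftrightarrow>
     G 1 = Gamma \<and>
     (\<forall>n\<ge>1. G n nicely_meromorphic_on UNIV) \<and>
     (\<forall>n\<ge>1. G n 1 = 1) \<and>
     (\<forall>n\<ge>1. \<forall>\<^sub>\<approx>z. G (n + 1) (z + 1) = G (n + 1) z / G n z) \<and>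
     (\<forall>n\<ge>1. \<forall>x::real. x > 0 \<longrightarrow>
        G n (complex_of_real x) \<in> \<real> \<and> Re (G n (complex_of_real x)) > 0) \<and>
     (\<forall>n\<ge>1. \<forall>x::real. x > 0 \<longrightarrow>
        (-1) ^ (n + 1) * (deriv ^^ (n + 1)) (\<lambda>t::real. ln (Re (G n (complex_of_real t)))) x \<ge> 0)"

text \<open>
  The conditions determine the functions with index at least 1 uniquely, but say nothing about
  index 0. The description is therefore applied to the single function at index \<open>n\<close>;
  only \<open>n \<ge> 1\<close> is meaningful.
\<close>

definition multiple_Gamma :: "nat \<Rightarrow> complex \<Rightarrow> complex" where
  "multiple_Gamma n = (THE f. \<exists>G. multiple_Gamma_family G \<and> f = G n)"

end

theory Submission
  imports Defs
begin

text \<open>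
  The function \<open>1 / \<Gamma>\<^sub>n(1 + z)\<close> has a Weierstrass product of genus \<open>n\<close>: it equals
  \<open>exp (P\<^sub>n(z))\<close> times the product over \<open>k \<ge> 1\<close> of
  \<open>((1 + z/k) exp (- z/k + z\<^sup>2/(2k\<^sup>2) - \<dots>))\<close> to the power \<open>binomial (n + k - 2) (n - 1)\<close>, where
  \<open>P\<^sub>n\<close> is a polynomial of degree at most \<open>n\<close> without constant term. If the power sums of \<open>a\<close> and
  \<open>b\<close> agree up to order \<open>n\<close>, all exponential factors cancel in the quotient of the products over
  the \<open>a\<^sub>l\<close> and the \<open>b\<^sub>l\<close>, which leaves the claim.

  The products satisfy the functional equation up to the exponential of a polynomial of degree at
  most \<open>n\<close>, so \<open>P\<^sub>n\<close> is found recursively by inverting the backward difference operator. Conversely,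
  the logarithms of two solutions differ by a 1-periodic function on the positive reals; the
  sign condition on the derivative of one of them and the decay of that of the Weierstrass product
  force this function to be constant.
\<close>

text \<open>
  Indices are shifted throughout: \<open>m\<close> stands for \<open>n - 1\<close>, and the factor with index \<open>k\<close> vanishes
  at \<open>- (k + 1)\<close>.
\<close>

subsection \<open>The Weierstrass products\<close>

text \<open>Minus the Taylor polynomial of \<open>ln (1 + u)\<close> of degree \<open>m + 1\<close>.
  The type stays open because real and complex arguments both occur.\<close>

definition wexp :: "nat \<Rightarrow> 'a \<Rightarrow> 'a::real_normed_field" where
  "wexp m u = (\<Sum>j=1..Suc m. (-u) ^ j / of_nat j)"

definition glog :: "nat \<Rightarrow> nat \<Rightarrow> 'a \<Rightarrow> 'a::{ln,real_normed_field}" where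
  "glog m k z = of_nat ((m + k) choose m) *
     (ln (1 + z / of_nat (Suc k)) + wexp m (z / of_nat (Suc k)))"

definition gfac :: "nat \<Rightarrow> nat \<Rightarrow> complex \<Rightarrow> complex" where
  "gfac m k z =
     ((1 + z / of_nat (Suc k)) * exp (wexp m (z / of_nat (Suc k)))) ^ ((m + k) choose m)"

definition wlog :: "nat \<Rightarrow> 'a \<Rightarrow> 'a::{ln,real_normed_field}" where
  "wlog m z = (\<Sum>k. glog m k z)"

definition wprod :: "nat \<Rightarrow> complex \<Rightarrow> complex" where
  "wprod m z = (\<Prod>k. gfac m k z)"

lemma wexp_0 [simp]: "wexp m 0 = 0"
  unfolding wexp_def by (intro sum.neutral) auto

lemma wexp_of_real: "wexp m (of_real x) = (of_real (wexp m x) :: complex)"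
  by (simp add: wexp_def)

lemma wexp_holomorphic [holomorphic_intros]:
  "f holomorphic_on A \<Longrightarrow> (\<lambda>z. wexp m (f z)) holomorphic_on A"
  unfolding wexp_def by (intro holomorphic_intros) auto

text \<open>\<open>wexp\<close> removes the terms of the logarithm series up to order
  \<open>m + 1\<close>; the tail is dominated by a geometric series of ratio at most 1/2.\<close>

lemma norm_Ln_plus_wexp_le:
  fixes u :: complex
  assumes u: "norm u \<le> 1/2"
  shows "norm (ln (1 + u) + wexp m u) \<le> 2 * norm u ^ (m + 2)"
proof -
  have lt: "norm u < 1" using u by simp
  \<comment> \<open>The term at \<open>n = 0\<close> is a division by zero and therefore 0.\<close>
  define f where "f = (\<lambda>n. - ((-u) ^ n) / of_nat n :: complex)"
  have "f sums ln (1 + u)"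
    unfolding f_def by (rule Ln_series'[OF lt])
  hence "(\<lambda>n. f (n + (m + 2))) sums (ln (1 + u) - (\<Sum>i<m+2. f i))"
    by (rule sums_split_initial_segment)
  moreover have "(\<Sum>i<m+2. f i) = - wexp m u"
  proof -
    have "{..<m+2} = insert 0 {1..Suc m}" by auto
    hence "(\<Sum>i<m+2. f i) = f 0 + (\<Sum>i=1..Suc m. f i)" by simp
    also have "\<dots> = - wexp m u"
      by (simp add: f_def wexp_def sum_negf)
    finally show ?thesis .
  qed
  ultimately have s: "(\<lambda>n. f (n + (m + 2))) sums (ln (1 + u) + wexp m u)" by simp
  have g: "(\<lambda>n. norm u ^ (m + 2) * norm u ^ n) sums (norm u ^ (m + 2) * (1 / (1 - norm u)))"
    by (intro sums_mult geometric_sums) (use lt in auto)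
  have le: "norm (f (n + (m + 2))) \<le> norm u ^ (m + 2) * norm u ^ n" for n
  proof -
    have "norm (f (n + (m + 2))) = norm u ^ (n + (m + 2)) / real (n + (m + 2))"
      unfolding f_def by (simp only: norm_divide norm_minus_cancel norm_power norm_of_nat)
    also have "\<dots> \<le> norm u ^ (n + (m + 2)) / 1"
      by (intro divide_left_mono) auto
    finally show ?thesis by (simp add: power_add mult_ac)
  qed
  have "norm (ln (1 + u) + wexp m u) \<le> norm u ^ (m + 2) * (1 / (1 - norm u))"
    using norm_suminf_le[OF le sums_summable[OF g]] s g by (simp add: sums_iff)
  also have "\<dots> \<le> norm u ^ (m + 2) * 2"
    using u by (intro mult_left_mono) (auto simp: field_simps)
  finally show ?thesis by (simp add: mult.commute)
qed

text \<open>Induction by absorption, with \<open>Suc m + k \<le> Suc m * Suc k\<close>.\<close>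

lemma binomial_add_le_power: "(m + k) choose m \<le> Suc k ^ m"
proof (induction m)
  case (Suc m)
  have "Suc m * ((Suc m + k) choose Suc m) = (Suc m + k) * ((m + k) choose m)"
    using Suc_times_binomial_eq[of "m + k" m] by (simp add: mult.commute)
  also have "\<dots> \<le> (Suc m * Suc k) * Suc k ^ m"
    by (intro mult_mono Suc) auto
  finally have "Suc m * ((Suc m + k) choose Suc m) \<le> Suc m * Suc k ^ Suc m"
    by (simp only: power_Suc mult_ac)
  thus ?case by (metis mult_le_cancel1 zero_less_Suc)
qed auto

text \<open>The multiplicity grows at most like \<open>Suc k ^ m\<close>, while the logarithmic
  remainder decays with exponent \<open>m + 2\<close>. Cutting \<open>wexp\<close> at order
  \<open>m + 1\<close> thus leaves a summable inverse square.\<close>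

lemma norm_glog_le:
  fixes z :: complex
  assumes "norm z \<le> R" "2 * R \<le> real (Suc k)"
  shows "norm (glog m k z) \<le> 2 * R ^ (m + 2) * (1 / real (Suc k) ^ 2)"
proof -
  define u where "u = z / of_nat (Suc k)"
  have R: "R \<ge> 0" using assms(1) norm_ge_zero order_trans by blast
  have nu: "norm u = norm z / real (Suc k)"
    by (simp only: u_def norm_divide norm_of_nat)
  have "norm u \<le> 1/2"
    unfolding nu using assms by (simp add: field_simps)
  hence "norm (ln (1 + u) + wexp m u) \<le> 2 * norm u ^ (m + 2)"
    by (rule norm_Ln_plus_wexp_le)
  also have "\<dots> \<le> 2 * (R / real (Suc k)) ^ (m + 2)"
    unfolding nu using assms by (intro mult_left_mono power_mono divide_right_mono) auto
  finally have 1: "norm (ln (1 + u) + wexp m u) \<le> 2 * (R / real (Suc k)) ^ (m + 2)" .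
  have "norm (glog m k z) = real ((m + k) choose m) * norm (ln (1 + u) + wexp m u)"
    by (simp only: glog_def u_def norm_mult norm_of_nat)
  also have "\<dots> \<le> real (Suc k ^ m) * (2 * (R / real (Suc k)) ^ (m + 2))"
    by (intro mult_mono 1) (use R binomial_add_le_power[of m k] in \<open>auto simp del: of_nat_power of_nat_Suc\<close>)
  also have "\<dots> = 2 * R ^ (m + 2) * (1 / real (Suc k) ^ 2)"
    by (simp add: power_divide power_add power2_eq_square del: of_nat_Suc)
  finally show ?thesis .
qed

section \<open>Convergence of the logarithmic series and of the product\<close>

lemma summable_inverse_Suc_square: "summable (\<lambda>k. 1 / real (Suc k) ^ 2)"
  using summable_Suc_iff[of "\<lambda>n. inverse (real n ^ 2)"] inverse_power_summable[of 2, where 'a = real]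
  by (simp add: inverse_eq_divide del: of_nat_Suc)

lemma eventually_two_R_le: "eventually (\<lambda>k. 2 * R \<le> real (Suc k)) sequentially"
  using eventually_ge_at_top[of "nat \<lceil>2 * R\<rceil>"] by eventually_elim linarith

text \<open>M-test. The bound holds once \<open>Suc k \<ge> 2 * R\<close>, and the finitely many
  earlier terms do not affect uniform convergence.\<close>

lemma glog_uniform_limit:
  "uniform_limit (cball 0 R) (\<lambda>N z. \<Sum>k<N. glog m k z) (wlog m :: complex \<Rightarrow> complex) sequentially"
proof -
  have "uniform_limit (cball 0 R) (\<lambda>N z. \<Sum>k<N. glog m k z)
          (\<lambda>z::complex. \<Sum>k. glog m k z) sequentially"
  proof (rule Weierstrass_m_test_ev)
    show "\<forall>\<^sub>F k in sequentially. \<forall>z\<in>cball 0 R. norm (glog m k z :: complex) \<le> 2 * R ^ (m + 2) * (1 / real (Suc k) ^ 2)"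
      using eventually_two_R_le[of R]
    proof eventually_elim
      case (elim k)
      thus ?case using norm_glog_le[where R = R] by (auto simp del: of_nat_Suc power_Suc)
    qed
  qed (intro summable_mult summable_inverse_Suc_square)
  thus ?thesis by (simp add: wlog_def[abs_def])
qed

lemma summable_glog: "summable (\<lambda>k. glog m k (z::complex))"
proof -
  have "(\<lambda>N. \<Sum>k<N. glog m k z) \<longlonglongrightarrow> wlog m z"
    by (rule tendsto_uniform_limitI[OF glog_uniform_limit[where R = "norm z"]]) auto
  thus ?thesis by (auto simp: summable_def sums_def)
qed

lemma exp_glog:
  assumes "1 + z / of_nat (Suc k) \<noteq> 0"
  shows "exp (glog m k z) = gfac m k z"
  using assms by (simp add: glog_def gfac_def exp_of_nat_mult exp_add del: of_nat_Suc)

lemma one_plus_divide_Suc_eq_0_iff: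
  "1 + z / of_nat (Suc k) = 0 \<longleftrightarrow> (z::complex) = - of_nat (Suc k)"
proof -
  have "(of_nat (Suc k) :: complex) \<noteq> 0" using of_nat_neq_0 by blast
  thus ?thesis by (simp add: field_simps eq_neg_iff_add_eq_0 del: of_nat_Suc)
qed

lemma gfac_eq_0_iff: "gfac m k z = 0 \<longleftrightarrow> z = - of_nat (Suc k)"
  unfolding gfac_def using one_plus_divide_Suc_eq_0_iff[of z k]
  by (simp del: of_nat_Suc)

lemma gfac_holomorphic: "gfac m k holomorphic_on A"
  unfolding gfac_def by (intro holomorphic_intros) auto

text \<open>The zero \<open>- of_nat (Suc k)\<close> lies outside the disc, so the factor is the
  exponential of a small number \<open>w\<close>, and
  \<open>norm (exp w - 1) \<le> 3/2 * norm w\<close>.\<close>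

lemma norm_gfac_minus_1_le:
  assumes "norm z \<le> R" "2 * R \<le> real (Suc k)" "2 * R ^ (m + 2) * (1 / real (Suc k) ^ 2) \<le> 1/2"
  shows "norm (gfac m k z - 1) \<le> 3 * R ^ (m + 2) * (1 / real (Suc k) ^ 2)"
proof -
  note b = norm_glog_le[OF assms(1,2), of m]
  have R: "0 \<le> R" using assms(1) norm_ge_zero order_trans by blast
  have "z \<noteq> - of_nat (Suc k)"
  proof
    assume "z = - of_nat (Suc k)"
    hence "norm z = real (Suc k)" by (simp only: norm_minus_cancel norm_of_nat)
    with assms R have "2 * real (Suc k) \<le> real (Suc k)" by linarith
    thus False by simp
  qed
  hence "gfac m k z = exp (glog m k z)"
    using one_plus_divide_Suc_eq_0_iff[of z k] by (intro exp_glog[symmetric]) blast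
  moreover have "norm (exp (glog m k z) - 1) \<le> 3 / 2 * norm (glog m k z)"
    using b assms(3) by (intro norm_exp_bounds) linarith
  ultimately show ?thesis using b by simp
qed

text \<open>The norm is doubled because the M-test is applied to the real series with terms
  \<open>norm (gfac m k z - 1)\<close>.\<close>

lemma gfac_minus_1_m_test:
  "\<forall>\<^sub>F k in sequentially. \<forall>z\<in>cball 0 R. norm (norm (gfac m k z - 1)) \<le> 3 * R ^ (m + 2) * (1 / real (Suc k) ^ 2)"
proof -
  have "(\<lambda>k. 2 * R ^ (m + 2) * (1 / real (Suc k) ^ 2)) \<longlonglongrightarrow> 0"
    by (intro summable_LIMSEQ_zero summable_mult summable_inverse_Suc_square)
  hence "\<forall>\<^sub>F k in sequentially. 2 * R ^ (m + 2) * (1 / real (Suc k) ^ 2) < 1/2"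
    by (rule order_tendstoD) auto
  with eventually_two_R_le[of R] show ?thesis
  proof eventually_elim
    case (elim k)
    thus ?case using norm_gfac_minus_1_le[where R = R and m = m and k = k]
      by (simp del: of_nat_Suc power_Suc add_2_eq_Suc')
  qed
qed

lemma gfac_convergent_prod: "convergent_prod (\<lambda>k. gfac m k z)"
proof (rule abs_convergent_prod_imp_convergent_prod, rule summable_imp_abs_convergent_prod)
  show "summable (\<lambda>k. norm (gfac m k z - 1))"
  proof (rule summable_comparison_test_ev)
    show "\<forall>\<^sub>F k in sequentially. norm (norm (gfac m k z - 1)) \<le> 3 * norm z ^ (m + 2) * (1 / real (Suc k) ^ 2)"
      using gfac_minus_1_m_test[of "norm z" m] by eventually_elim auto
  qed (intro summable_mult summable_inverse_Suc_square)
qed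

lemma gfac_LIMSEQ: "(\<lambda>N. \<Prod>k<N. gfac m k z) \<longlonglongrightarrow> wprod m z"
  using convergent_prod_LIMSEQ[OF gfac_convergent_prod, of m z]
  by (simp add: wprod_def LIMSEQ_lessThan_iff_atMost)

text \<open>A convergent product without zero factors is nonzero; conversely, one zero factor
  annihilates all late partial products.\<close>

lemma wprod_eq_0_iff: "wprod m z = 0 \<longleftrightarrow> (\<exists>k. z = - of_nat (Suc k))"
proof
  assume "wprod m z = 0"
  thus "\<exists>k. z = - of_nat (Suc k)"
    using prodinf_nonzero[OF gfac_convergent_prod[of m z]] gfac_eq_0_iff[of m _ z]
    by (auto simp: wprod_def simp del: of_nat_Suc)
next
  assume "\<exists>k. z = - of_nat (Suc k)"
  then obtain k where "gfac m k z = 0" by (auto simp: gfac_eq_0_iff simp del: of_nat_Suc)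
  hence "eventually (\<lambda>N. (\<Prod>k<N. gfac m k z) = 0) sequentially"
    by (intro eventually_mono[OF eventually_gt_at_top[of k]] prod_zero) auto
  hence "(\<lambda>N. \<Prod>k<N. gfac m k z) \<longlonglongrightarrow> 0" by (simp add: tendsto_eventually)
  thus "wprod m z = 0" using gfac_LIMSEQ LIMSEQ_unique by blast
qed

lemma wprod_holomorphic: "wprod m holomorphic_on A"
proof (rule holomorphic_on_subset)
  show "wprod m holomorphic_on UNIV"
  proof (rule holomorphic_uniform_sequence)
    show "(\<lambda>z. \<Prod>k<N. gfac m k z) holomorphic_on UNIV" for N
      by (intro holomorphic_intros gfac_holomorphic)
  next
    fix z :: complex
    \<comment> \<open>Large enough for the disc about 0 to contain the closed unit disc about
      \<open>z\<close>.\<close>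
    define R where "R = norm z + 1"
    have "uniformly_convergent_on (cball 0 R) (\<lambda>N z. \<Prod>k<N. gfac m k z)"
    proof (rule uniformly_convergent_on_prod')
      show "uniformly_convergent_on (cball 0 R) (\<lambda>N z. \<Sum>k<N. norm (gfac m k z - 1))"
        by (rule Weierstrass_m_test'_ev[OF gfac_minus_1_m_test])
           (intro summable_mult summable_inverse_Suc_square)
      show "continuous_on (cball 0 R) (gfac m k)" for k
        by (intro holomorphic_on_imp_continuous_on gfac_holomorphic)
    qed auto
    then obtain g where g: "uniform_limit (cball 0 R) (\<lambda>N z. \<Prod>k<N. gfac m k z) g sequentially"
      by (auto simp: uniformly_convergent_on_def)
    have "g w = wprod m w" if "w \<in> cball 0 R" for w
      using tendsto_uniform_limitI[OF g that] gfac_LIMSEQ LIMSEQ_unique by blast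
    with g have "uniform_limit (cball 0 R) (\<lambda>N z. \<Prod>k<N. gfac m k z) (wprod m) sequentially"
      by (subst (asm) uniform_limit_cong'[where g = "\<lambda>N z. \<Prod>k<N. gfac m k z" and i = "wprod m"]) auto
    hence "uniform_limit (cball z 1) (\<lambda>N z. \<Prod>k<N. gfac m k z) (wprod m) sequentially"
      by (rule uniform_limit_on_subset) (simp add: cball_subset_cball_iff R_def)
    thus "\<exists>d>0. cball z d \<subseteq> UNIV \<and> uniform_limit (cball z d) (\<lambda>N z. \<Prod>k<N. gfac m k z) (wprod m) sequentially"
      by (intro exI[of _ 1]) auto
  qed auto
qed auto

text \<open>Branches do not matter: \<open>exp\<close> turns each principal logarithm back into its
  factor, and continuity handles the limit. The excluded points are the zeros of the
  factors.\<close>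

lemma exp_wlog:
  assumes "\<And>k. z \<noteq> - of_nat (Suc k)"
  shows "exp (wlog m z) = wprod m z"
proof -
  have "(\<lambda>N. exp (\<Sum>k<N. glog m k z)) \<longlonglongrightarrow> exp (wlog m z)"
    unfolding wlog_def by (intro tendsto_exp summable_LIMSEQ summable_glog)
  also have "(\<lambda>N. exp (\<Sum>k<N. glog m k z)) = (\<lambda>N. \<Prod>k<N. gfac m k z)"
  proof -
    have "exp (glog m k z) = gfac m k z" for k
      using one_plus_divide_Suc_eq_0_iff[of z k] assms[of k] by (intro exp_glog) blast
    thus ?thesis by (simp add: exp_sum)
  qed
  finally show ?thesis using gfac_LIMSEQ LIMSEQ_unique by blast
qed

section \<open>The logarithm on the half-line and on the half-plane to the right of -1\<close>

lemma glog_of_real: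
  assumes "x > -1"
  shows "glog m k (of_real x) = (of_real (glog m k x) :: complex)"
proof -
  have "1 + x / real (Suc k) > 0"
  proof -
    have "x + real (Suc k) > 0" using assms by simp
    hence "(x + real (Suc k)) / real (Suc k) > 0" by (intro divide_pos_pos) auto
    thus ?thesis by (simp add: add_divide_distrib add.commute del: of_nat_Suc)
  qed
  hence "ln (complex_of_real (1 + x / real (Suc k))) = of_real (ln (1 + x / real (Suc k)))"
    by (rule Ln_of_real)
  moreover have "complex_of_real x / of_nat (Suc k) = of_real (x / real (Suc k))"
    by simp
  moreover have "wexp m (complex_of_real (x / real (Suc k))) = of_real (wexp m (x / real (Suc k)))"
    by (rule wexp_of_real)
  ultimately show ?thesis
    unfolding glog_def by (simp del: of_nat_Suc of_real_divide)
qed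

text \<open>Links the real and complex instances of \<open>wlog\<close>: difference equations are
  solved over the reals, derivatives are computed over the complex numbers.\<close>

lemma
  assumes "x > -1"
  shows glog_sums_real: "(\<lambda>k. glog m k x) sums wlog m (x::real)"
    and wlog_of_real: "wlog m (of_real x) = (of_real (wlog m x) :: complex)"
proof -
  have "summable (\<lambda>k. complex_of_real (glog m k x))"
    using summable_glog[of m "of_real x"] assms by (simp add: glog_of_real)
  hence s: "summable (\<lambda>k. glog m k x)" by (simp add: summable_complex_of_real)
  thus "(\<lambda>k. glog m k x) sums wlog m x"
    unfolding wlog_def by (rule summable_sums)
  show "wlog m (of_real x) = (of_real (wlog m x) :: complex)"
    unfolding wlog_def using assms s by (simp add: glog_of_real suminf_of_real)
qed

lemma one_plus_divide_Suc_not_nonpos: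
  fixes z :: complex
  assumes "Re z > -1"
  shows "1 + z / of_nat (Suc k) \<notin> \<real>\<^sub>\<le>\<^sub>0"
proof -
  have "Re z + real (Suc k) > 0" using assms by simp
  hence "(Re z + real (Suc k)) / real (Suc k) > 0" by (intro divide_pos_pos) auto
  hence "Re (1 + z / of_nat (Suc k)) > 0"
    by (simp add: add_divide_distrib add.commute Re_divide_of_nat del: of_nat_Suc)
  thus ?thesis by (auto simp: complex_nonpos_Reals_iff)
qed

lemma glog_holomorphic: "glog m k holomorphic_on {z. Re z > -1}"
  unfolding glog_def
  using one_plus_divide_Suc_not_nonpos[of _ k]
  by (intro holomorphic_intros) (auto simp del: of_nat_Suc)

text \<open>The local form of convergence under which holomorphy and higher derivatives pass to the
  limit.\<close>

lemma wlog_uniform_limit_ball: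
  assumes "Re z > -1"
  obtains r where "r > 0" "ball z r \<subseteq> {z. Re z > -1}"
    "uniform_limit (ball z r) (\<lambda>N z. \<Sum>k<N. glog m k z) (wlog m) sequentially"
proof -
  obtain r where r: "r > 0" "ball z r \<subseteq> {z. Re z > -1}"
    using open_halfspace_Re_gt[of "-1"] assms unfolding open_contains_ball by blast
  have "uniform_limit (ball z r) (\<lambda>N z. \<Sum>k<N. glog m k z) (wlog m) sequentially"
    by (rule uniform_limit_on_subset[OF glog_uniform_limit[where R = "norm z + r"]])
       (use r in \<open>auto simp: ball_subset_cball_iff\<close>)
  with r show ?thesis by (rule that)
qed

lemma wlog_holomorphic: "wlog m holomorphic_on {z. Re z > -1}"
proof (rule holomorphic_uniform_sequence)
  show "(\<lambda>z. \<Sum>k<N. glog m k z) holomorphic_on {z. Re z > -1}" for N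
    by (intro holomorphic_intros glog_holomorphic)
next
  fix z :: complex
  assume "z \<in> {z. Re z > -1}"
  then obtain r where "r > 0" "ball z r \<subseteq> {z. Re z > -1}"
    "uniform_limit (ball z r) (\<lambda>N z. \<Sum>k<N. glog m k z) (wlog m) sequentially"
    using wlog_uniform_limit_ball[of z m] by auto
  moreover have "cball z (r/2) \<subseteq> ball z r" using \<open>r > 0\<close> by (auto simp: dist_commute)
  ultimately show "\<exists>d>0. cball z d \<subseteq> {z. Re z > -1} \<and> uniform_limit (cball z d) (\<lambda>N z. \<Sum>k<N. glog m k z) (wlog m) sequentially"
    by (intro exI[of _ "r/2"]) (auto intro: uniform_limit_on_subset)
qed (rule open_halfspace_Re_gt)

section \<open>Higher derivatives of the logarithm\<close>

lemma higher_deriv_chain: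
  fixes f :: "nat \<Rightarrow> 'a::real_normed_field \<Rightarrow> 'a"
  assumes "open S"
    and deriv: "\<And>j z. z \<in> S \<Longrightarrow> (f j has_field_derivative f (Suc j) z) (at z)"
    and "z \<in> S"
  shows "(deriv ^^ j) (f 0) z = f j z"
  using \<open>z \<in> S\<close>
proof (induction j arbitrary: z)
  case (Suc j)
  \<comment> \<open>Openness upgrades the pointwise induction hypothesis to a neighbourhood, where
    it may be differentiated.\<close>
  have "eventually (\<lambda>w. (deriv ^^ j) (f 0) w = f j w) (nhds z)"
    using eventually_nhds_in_open[OF \<open>open S\<close> Suc.prems] by eventually_elim (rule Suc.IH)
  hence "deriv ((deriv ^^ j) (f 0)) z = deriv (f j) z"
    by (rule deriv_cong_ev) simp
  also have "\<dots> = f (Suc j) z"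
    by (rule DERIV_imp_deriv[OF deriv[OF Suc.prems]])
  finally show ?case by simp
qed simp

text \<open>\<open>wexp m (c * x)\<close> as a formal polynomial in \<open>x\<close>, so that
  degrees and \<open>pderiv\<close> are available; \<open>c\<close> will be a reciprocal
  \<open>1 / Suc k\<close> or \<open>1 / N\<close>.\<close>

definition wpoly :: "nat \<Rightarrow> 'a \<Rightarrow> 'a::real_normed_field poly" where
  "wpoly m c = (\<Sum>j=1..Suc m. monom ((-c) ^ j / of_nat j) j)"

lemma poly_wpoly: "poly (wpoly m c) x = wexp m (c * x)"
proof -
  have "poly (wpoly m c) x = (\<Sum>j=1..Suc m. (-c) ^ j / of_nat j * x ^ j)"
    unfolding wpoly_def by (simp only: poly_sum poly_monom)
  also have "\<dots> = wexp m (c * x)"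
    unfolding wexp_def
  proof (intro sum.cong refl)
    fix j
    have "(- (c * x)) ^ j = (- c) ^ j * x ^ j"
      by (subst power_mult_distrib[symmetric]) simp
    thus "(- c) ^ j / of_nat j * x ^ j = (- (c * x)) ^ j / of_nat j" by simp
  qed
  finally show ?thesis .
qed

lemma degree_wpoly: "degree (wpoly m c) \<le> Suc m"
  unfolding wpoly_def by (intro degree_sum_le) (auto intro: order_trans[OF degree_monom_le])

lemma higher_pderiv_eq_0:
  fixes p :: "'a::field_char_0 poly"
  shows "degree p < n \<Longrightarrow> (pderiv ^^ n) p = 0"
proof (induction n arbitrary: p)
  case (Suc n)
  show ?case
  proof (cases "degree p = 0")
    case True
    hence "pderiv p = 0" by (simp add: pderiv_eq_0_iff)
    thus ?thesis by (simp only: funpow_Suc_right o_apply higher_pderiv_0)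
  next
    case False
    with Suc have "(pderiv ^^ n) (pderiv p) = 0" by (simp add: degree_pderiv)
    thus ?thesis by (simp only: funpow_Suc_right o_apply)
  qed
qed simp

text \<open>Differentiating \<open>m + 2\<close> times kills the polynomial part, whose degree is at
  most \<open>m + 1\<close>, and leaves the derivative of the logarithm.\<close>

lemma higher_deriv_glog:
  assumes z: "Re z > -1"
  shows "(deriv ^^ (m + 2)) (glog m k) z =
     of_nat ((m + k) choose m) * ((-1) ^ (m + 1) * fact (m + 1) / (of_nat (Suc k) + z) ^ (m + 2))"
proof -
  define c where "c = (of_nat ((m + k) choose m) :: complex)"
  define K where "K = (of_nat (Suc k) :: complex)"
  define q where "q = wpoly m (1 / K)"
  define f where "f = (\<lambda>j z. c * ((case j of 0 \<Rightarrow> ln (1 + z / K) | Suc i \<Rightarrow> (-1) ^ i * fact i / (K + z) ^ Suc i)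
      + poly ((pderiv ^^ j) q) z))"
  have K0: "K \<noteq> 0" unfolding K_def using of_nat_neq_0 by blast
  have f0: "f 0 = glog m k"
    by (rule ext) (simp add: f_def glog_def c_def K_def q_def poly_wpoly del: of_nat_Suc)
  have nz: "K + w \<noteq> 0" if "w \<in> {z. Re z > -1}" for w
  proof
    assume "K + w = 0"
    hence "Re (K + w) = 0" by simp
    thus False using that by (simp add: K_def)
  qed
  have "(deriv ^^ (m + 2)) (f 0) z = f (m + 2) z"
  proof (rule higher_deriv_chain[where S = "{z. Re z > -1}"])
    fix j w assume w: "w \<in> {z. Re z > -1}"
    have *: "1 + w / K = (K + w) / K" using K0 by (simp add: field_simps)
    have nr: "1 + w / K \<notin> \<real>\<^sub>\<le>\<^sub>0"
      using one_plus_divide_Suc_not_nonpos[of w k] w by (simp add: K_def)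
    have 1: "((\<lambda>z. case j of 0 \<Rightarrow> ln (1 + z / K) | Suc i \<Rightarrow> (-1) ^ i * fact i / (K + z) ^ Suc i)
      has_field_derivative ((-1) ^ j * fact j / (K + w) ^ Suc j)) (at w)"
    proof (cases j)
      case 0
      have "((\<lambda>z. ln (1 + z / K)) has_field_derivative inverse (1 + w / K) * (1 / K)) (at w)"
        using nr K0 by (auto intro!: derivative_eq_intros)
      thus ?thesis using 0 K0 by (simp add: *)
    next
      case (Suc i)
      have "((\<lambda>z. (-1) ^ i * fact i / (K + z) ^ Suc i) has_field_derivative
         - ((-1) ^ i * fact i * (of_nat (Suc i) * (K + w) ^ i)) / ((K + w) ^ Suc i * (K + w) ^ Suc i)) (at w)"
      proof -
        have "((\<lambda>z. (K + z) ^ Suc i) has_field_derivative of_nat (Suc i) * (K + w) ^ i) (at w)"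
        proof -
          have "((\<lambda>z. K + z) has_field_derivative 1) (at w)" by (auto intro!: derivative_eq_intros)
          from DERIV_power_Suc[OF this, of i] show ?thesis by (simp del: power_Suc)
        qed
        from DERIV_divide[OF DERIV_const this] nz[OF w]
        have "((\<lambda>z. A / (K + z) ^ Suc i) has_field_derivative
         - (A * (of_nat (Suc i) * (K + w) ^ i)) / ((K + w) ^ Suc i * (K + w) ^ Suc i)) (at w)" for A
          by (simp del: power_Suc of_nat_Suc)
        thus ?thesis .
      qed
      also have "- ((-1) ^ i * fact i * (of_nat (Suc i) * (K + w) ^ i)) / ((K + w) ^ Suc i * (K + w) ^ Suc i)
          = (-1) ^ Suc i * fact (Suc i) / (K + w) ^ Suc (Suc i)"
      proof -
        have "(K + w) ^ Suc i * (K + w) ^ Suc i = (K + w) ^ i * (K + w) ^ Suc (Suc i)"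
          by (simp add: mult_ac)
        moreover have "- ((-1) ^ i * fact i * (of_nat (Suc i) * (K + w) ^ i)) =
            (K + w) ^ i * ((-1) ^ Suc i * fact (Suc i))"
          by (simp add: mult_ac del: of_nat_Suc)
        ultimately show ?thesis using nz[OF w] by (simp only: mult_divide_mult_cancel_left_if) simp
      qed
      finally show ?thesis using Suc by simp
    qed
    have 2: "((\<lambda>z. poly ((pderiv ^^ j) q) z) has_field_derivative poly ((pderiv ^^ Suc j) q) w) (at w)"
      using poly_DERIV[of "(pderiv ^^ j) q" w] by simp
    show "(f j has_field_derivative f (Suc j) w) (at w)"
      unfolding f_def using DERIV_cmult[OF DERIV_add[OF 1 2], of c] by simp
  qed (use z open_halfspace_Re_gt in auto)
  moreover have "(pderiv ^^ (m + 2)) q = 0"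
    using degree_wpoly[of m "1/K"] by (intro higher_pderiv_eq_0) (simp add: q_def)
  ultimately have "(deriv ^^ (m + 2)) (glog m k) z = c * ((-1) ^ (m + 1) * fact (m + 1) / (K + z) ^ (m + 2))"
    unfolding f0 by (simp add: f_def)
  thus ?thesis by (simp only: c_def K_def)
qed

text \<open>The majorant behind the decay bound \<open>1 / x\<close> in the next lemma.\<close>

lemma telescope_inverse_sums:
  assumes "(x::real) > 0"
  shows "(\<lambda>k. 1 / (real k + x) - 1 / (real (Suc k) + x)) sums (1 / x)"
proof -
  have "(\<lambda>k. 1 / (real k + x)) \<longlonglongrightarrow> 0" by real_asymp
  from telescope_sums'[OF this] show ?thesis by simp
qed

text \<open>Here \<open>s\<close> is the sum of a series of nonnegative terms. Its sign yields the
  log-convexity condition, its bound the decay needed for uniqueness.\<close>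

lemma higher_deriv_wlog:
  assumes x: "x > -1"
  obtains s where "s \<ge> 0" "x > 0 \<Longrightarrow> s \<le> 1 / x"
    "(deriv ^^ (m + 2)) (wlog m) (complex_of_real x) = of_real ((-1) ^ (m + 1) * fact (m + 1) * s)"
proof -
  define t where "t = (\<lambda>k. real ((m + k) choose m) / (real (Suc k) + x) ^ (m + 2))"
  define c where "c = (-1) ^ (m + 1) * (fact (m + 1) :: real)"
  have c0: "c \<noteq> 0" by (simp add: c_def)
  have pos: "real (Suc k) + x > 0" for k using x by simp
  obtain r where r: "r > 0" "ball (complex_of_real x) r \<subseteq> {z. Re z > -1}"
    "uniform_limit (ball (complex_of_real x) r) (\<lambda>N z. \<Sum>k<N. glog m k z) (wlog m) sequentially"
    using wlog_uniform_limit_ball[of "complex_of_real x" m] x by (simp, blast)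
  have hol: "glog m k holomorphic_on ball (complex_of_real x) r" for k
    using glog_holomorphic r(2) holomorphic_on_subset by blast
  have hd: "(deriv ^^ (m + 2)) (glog m k) (complex_of_real x) = of_real (c * t k)" for k
    using x by (subst higher_deriv_glog) (simp_all add: c_def t_def)
  have "(\<lambda>N. (deriv ^^ (m + 2)) (\<lambda>z. \<Sum>k<N. glog m k z) (complex_of_real x))
      \<longlonglongrightarrow> (deriv ^^ (m + 2)) (wlog m) (complex_of_real x)"
    by (rule higher_deriv_complex_uniform_limit[OF r(3)])
       (use r(1) hol in \<open>auto intro!: always_eventually holomorphic_intros\<close>)
  also have "(\<lambda>N. (deriv ^^ (m + 2)) (\<lambda>z. \<Sum>k<N. glog m k z) (complex_of_real x)) =
             (\<lambda>N. of_real (c * (\<Sum>k<N. t k)))"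
  proof
    fix N
    show "(deriv ^^ (m + 2)) (\<lambda>z. \<Sum>k<N. glog m k z) (complex_of_real x) = of_real (c * (\<Sum>k<N. t k))"
    proof (induction N)
      case (Suc N)
      have "(deriv ^^ (m + 2)) (\<lambda>z. (\<Sum>k<N. glog m k z) + glog m N z) (complex_of_real x) =
         (deriv ^^ (m + 2)) (\<lambda>z. (\<Sum>k<N. glog m k z)) (complex_of_real x) + (deriv ^^ (m + 2)) (\<lambda>z. glog m N z) (complex_of_real x)"
        by (rule higher_deriv_add[where S = "ball (complex_of_real x) r"])
           (use r(1) hol in \<open>auto intro!: holomorphic_intros\<close>)
      thus ?case using Suc hd[of N] by (simp add: algebra_simps del: funpow.simps)
    qed (simp del: funpow.simps)
  qed
  finally have lim: "(\<lambda>N. complex_of_real (c * (\<Sum>k<N. t k))) \<longlonglongrightarrow> (deriv ^^ (m + 2)) (wlog m) (complex_of_real x)" .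
  \<comment> \<open>Summability of \<open>t\<close> is read off from the existing complex limit:
    take real parts and divide by \<open>c\<close>.\<close>
  hence "(\<lambda>N. Re (complex_of_real (c * (\<Sum>k<N. t k)))) \<longlonglongrightarrow> Re ((deriv ^^ (m + 2)) (wlog m) (complex_of_real x))"
    by (rule tendsto_Re)
  hence "(\<lambda>N. inverse c * (c * (\<Sum>k<N. t k))) \<longlonglongrightarrow> inverse c * Re ((deriv ^^ (m + 2)) (wlog m) (complex_of_real x))"
    by (intro tendsto_mult tendsto_const) simp
  hence "t sums (inverse c * Re ((deriv ^^ (m + 2)) (wlog m) (complex_of_real x)))"
    using c0 by (simp add: sums_def mult.assoc[symmetric] del: funpow.simps)
  hence t: "t sums suminf t" by (rule summable_sums[OF sums_summable])
  hence "(\<lambda>N. complex_of_real (c * (\<Sum>k<N. t k))) \<longlonglongrightarrow> of_real (c * suminf t)"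
    unfolding sums_def by (intro tendsto_intros)
  with lim have eq: "(deriv ^^ (m + 2)) (wlog m) (complex_of_real x) = of_real (c * suminf t)"
    using LIMSEQ_unique by blast
  have nn: "t k \<ge> 0" for k unfolding t_def by (intro divide_nonneg_nonneg zero_le_power) (use pos[of k] in auto)
  have "suminf t \<ge> 0" by (rule suminf_nonneg[OF sums_summable[OF t] nn])
  moreover have "suminf t \<le> 1 / x" if "x > 0"
  proof (rule sums_le[OF _ t telescope_inverse_sums[OF that]])
    fix k
    \<comment> \<open>With this \<open>y\<close> the term is at most \<open>1 / y\<^sup>2\<close>,
      hence at most the telescoping \<open>1 / (y - 1) - 1 / y\<close>.\<close>
    define y where "y = real (Suc k) + x"
    have y: "y > 1" "real (Suc k) \<le> y" using that by (auto simp: y_def)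
    have "real ((m + k) choose m) \<le> real (Suc k ^ m)"
      using binomial_add_le_power by (rule of_nat_mono)
    also have "\<dots> \<le> y ^ m" using y(2) by (simp add: power_mono del: of_nat_Suc)
    finally have "t k \<le> y ^ m / y ^ (m + 2)"
      unfolding t_def y_def[symmetric] using y by (intro divide_right_mono) auto
    also have "\<dots> = 1 / (y * y)" using y by (simp add: power_add power2_eq_square)
    also have "\<dots> \<le> 1 / ((y - 1) * y)" using y by (intro divide_left_mono mult_right_mono mult_pos_pos) auto
    also have "\<dots> = 1 / (y - 1) - 1 / y" using y by (simp add: field_simps)
    finally show "t k \<le> 1 / (real k + x) - 1 / (real (Suc k) + x)" by (simp add: y_def)
  qed
  ultimately show ?thesis using that[of "suminf t"] eq by (simp only: c_def)
qed

subsection \<open>Polynomials\<close>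

text \<open>Induction on the degree: subtracting the value at a node \<open>a\<close> and dividing
  by \<open>x - a\<close> gives polynomials with a smaller degree bound, whose values still converge
  on the infinite set \<open>S - {a}\<close>.\<close>

lemma poly_pointwise_limit:
  fixes p :: "nat \<Rightarrow> 'a::real_normed_field poly"
  assumes "\<And>N. degree (p N) \<le> n" "infinite S"
    and "\<And>x. x \<in> S \<Longrightarrow> (\<lambda>N. poly (p N) x) \<longlonglongrightarrow> f x"
  shows "\<exists>q. degree q \<le> n \<and> (\<forall>x\<in>S. f x = poly q x)"
  using assms
proof (induction n arbitrary: p f S)
  case 0
  from 0(2) obtain a where a: "a \<in> S" using infinite_imp_nonempty by blast
  have "f x = poly [:f a:] x" if "x \<in> S" for x
  proof -
    have "poly (p N) x = poly (p N) a" for N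
    proof -
      obtain c where "p N = [:c:]" using 0(1)[of N] by (auto elim: degree_eq_zeroE)
      thus ?thesis by simp
    qed
    thus ?thesis using LIMSEQ_unique[OF 0(3)[OF that]] 0(3)[OF a] by simp
  qed
  moreover have "degree [:f a:] \<le> 0" by simp
  ultimately show ?case by blast
next
  case (Suc n)
  from Suc.prems(2) obtain a where a: "a \<in> S" using infinite_imp_nonempty by blast
  define q where "q = (\<lambda>N. synthetic_div (p N) a)"
  have p: "poly (p N) x = (x - a) * poly (q N) x + poly (p N) a" for N x
  proof -
    have "poly (p N) x = poly ([:- a, 1:] * q N + [:poly (p N) a:]) x"
      by (simp only: q_def synthetic_div_correct')
    thus ?thesis by (simp add: algebra_simps)
  qed
  have "\<exists>r. degree r \<le> n \<and> (\<forall>x\<in>S - {a}. (f x - f a) / (x - a) = poly r x)"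
  proof (rule Suc.IH[where p = q])
    show "degree (q N) \<le> n" for N
      using Suc.prems(1)[of N] by (simp add: q_def degree_synthetic_div)
    show "infinite (S - {a})" using Suc.prems(2) by simp
    fix x assume x: "x \<in> S - {a}"
    have "(\<lambda>N. (poly (p N) x - poly (p N) a) / (x - a)) \<longlonglongrightarrow> (f x - f a) / (x - a)"
      using x a by (intro tendsto_intros Suc.prems(3)) auto
    also have "(\<lambda>N. (poly (p N) x - poly (p N) a) / (x - a)) = (\<lambda>N. poly (q N) x)"
      using x by (intro ext) (subst p, simp)
    finally show "(\<lambda>N. poly (q N) x) \<longlonglongrightarrow> (f x - f a) / (x - a)" .
  qed
  then obtain r where r: "degree r \<le> n" "\<And>x. x \<in> S - {a} \<Longrightarrow> (f x - f a) / (x - a) = poly r x"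
    by blast
  have "f x = poly ([:-a, 1:] * r + [:f a:]) x" if "x \<in> S" for x
  proof (cases "x = a")
    case False
    hence "f x - f a = (x - a) * poly r x" using r(2)[of x] that by (simp add: field_simps)
    thus ?thesis by (simp add: algebra_simps)
  qed simp
  moreover have "degree ([:-a, 1:] * r + [:f a:]) \<le> Suc n"
    using r(1) degree_mult_le[of "[:-a, 1:]" r] by (intro degree_add_le) auto
  ultimately show ?case by blast
qed

text \<open>A multiple of a rising factorial, whose antidifference is explicit, cancels the leading
  term; induction does the rest.\<close>

lemma poly_antidifference:
  fixes p :: "real poly"
  assumes "degree p \<le> n"
  shows "\<exists>q. degree q \<le> Suc n \<and> poly q 0 = 0 \<and> (\<forall>x. poly q x - poly q (x - 1) = poly p x)"
  using assms
proof (induction n arbitrary: p)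
  case 0
  then obtain c where "p = [:c:]" by (auto elim: degree_eq_zeroE)
  thus ?case by (intro exI[of _ "[:0, c:]"]) (auto simp: algebra_simps)
next
  case (Suc n)
  \<comment> \<open>\<open>B n\<close> is the rising factorial
    \<open>x (x + 1) ... (x + n - 1)\<close>, which plays the role of the monomial for backward
    differences.\<close>
  define B where "B = (\<lambda>n. \<Prod>i<n. [:real i, 1:])"
  have degB: "degree (B n) = n" for n
    unfolding B_def by (subst degree_prod_eq_sum_degree) auto
  have leadB: "coeff (B n) n = 1" for n
    using lead_coeff_prod[of "\<lambda>i. [:real i, 1:]" "{..<n}"] degB[of n] by (simp add: B_def)
  have polyB: "poly (B n) x = (\<Prod>i<n. x + real i)" for n x
    by (simp add: B_def poly_prod add.commute)
  have diffB: "poly (B (Suc n)) x - poly (B (Suc n)) (x - 1) = real (Suc n) * poly (B n) x" for n x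
  proof -
    have "poly (B (Suc n)) x = poly (B n) x * (x + real n)" by (simp add: polyB)
    moreover have "poly (B (Suc n)) (x - 1) = (x - 1) * poly (B n) x"
      unfolding polyB by (subst prod.lessThan_Suc_shift) (simp add: o_def)
    ultimately show ?thesis by (simp add: algebra_simps)
  qed
  define c where "c = coeff p (Suc n)"
  have "degree (p - smult c (B (Suc n))) \<le> n"
  proof (rule degree_le, intro allI impI)
    fix i assume i: "n < i"
    show "coeff (p - smult c (B (Suc n))) i = 0"
    proof (cases "i = Suc n")
      case False
      with i have "i > Suc n" by simp
      thus ?thesis using Suc.prems degB[of "Suc n"] by (simp add: coeff_eq_0)
    qed (simp add: c_def leadB)
  qed
  from Suc.IH[OF this] obtain q where q: "degree q \<le> Suc n" "poly q 0 = 0"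
    "\<And>x. poly q x - poly q (x - 1) = poly (p - smult c (B (Suc n))) x" by blast
  \<comment> \<open>Dividing by \<open>n + 2\<close> undoes the factor that \<open>diffB\<close>
    produces for \<open>B (n + 2)\<close>.\<close>
  define r where "r = q + smult (c / real (n + 2)) (B (n + 2))"
  have "degree r \<le> Suc (Suc n)"
    unfolding r_def using q(1) degB[of "n + 2"]
    by (intro degree_add_le order_trans[OF degree_smult_le]) auto
  moreover have "poly r 0 = 0" using q(2) by (auto simp: r_def polyB)
  moreover have "poly r x - poly r (x - 1) = poly p x" for x
  proof -
    have "poly r x - poly r (x - 1) = (poly q x - poly q (x - 1)) +
      c / real (n + 2) * (poly (B (Suc (Suc n))) x - poly (B (Suc (Suc n))) (x - 1))"
      by (simp add: r_def algebra_simps)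
    thus ?thesis unfolding diffB q(3) by simp
  qed
  ultimately show ?case by blast
qed

text \<open>A shift preserves degree and leading coefficient, so the top terms cancel. For
  \<open>wpoly (Suc m)\<close> this lowers the degree bound from \<open>m + 2\<close> to
  \<open>m + 1\<close>.\<close>

lemma degree_pcompose_shift_diff:
  fixes q :: "'a::idom poly"
  assumes "degree q \<le> Suc n"
  shows "degree (pcompose q [:c, 1:] - q) \<le> n"
proof (rule degree_le, intro allI impI)
  have deg: "degree (pcompose q [:c, 1:]) = degree q" by (simp add: degree_pcompose)
  fix i assume i: "n < i"
  show "coeff (pcompose q [:c, 1:] - q) i = 0"
  proof (cases "i = degree q")
    case True
    have "lead_coeff (pcompose q [:c, 1:]) = lead_coeff q" by (subst lead_coeff_comp) auto
    thus ?thesis using True deg by simp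
  next
    case False
    hence "degree q < i" using i assms by simp
    thus ?thesis using deg by (simp add: coeff_eq_0)
  qed
qed

subsection \<open>The functional equation\<close>

text \<open>Isolates the logarithm that enters the summation by parts; the rest is polynomial in
  \<open>y\<close>.\<close>

lemma glog_real_split:
  fixes y :: real
  assumes "y > -1"
  shows "glog m k y = real ((m + k) choose m) *
     (ln (real (Suc k) + y) - ln (real (Suc k)) + poly (wpoly m (1 / real (Suc k))) y)"
proof -
  have "1 + y / real (Suc k) = (real (Suc k) + y) / real (Suc k)"
    by (simp add: field_simps del: of_nat_Suc)
  moreover have "real (Suc k) + y > 0" using assms by simp
  ultimately have "ln (1 + y / real (Suc k)) = ln (real (Suc k) + y) - ln (real (Suc k))"
    by (simp add: ln_div del: of_nat_Suc)
  thus ?thesis by (simp add: glog_def poly_wpoly del: of_nat_Suc)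
qed

text \<open>Since \<open>Suc k + (x - 1) = k + x\<close>, Pascal's rule makes the sum telescope; the
  lower boundary term has the coefficient \<open>m choose Suc m = 0\<close>.\<close>

lemma binomial_sum_by_parts:
  fixes x :: real
  shows "(\<Sum>k<N. real ((Suc m + k) choose Suc m) * ln (real (Suc k) + (x - 1))
        - real ((Suc m + k) choose Suc m) * ln (real (Suc k) + x)
        - real ((m + k) choose m) * ln (real (Suc k) + (x - 1)))
     = - (real ((m + N) choose Suc m) * ln (real N + x))"
proof (induction N)
  case (Suc N)
  have "(Suc m + N) choose Suc m = ((m + N) choose m) + ((m + N) choose Suc m)"
    by simp
  moreover have "real (Suc N) + (x - 1) = real N + x" by simp
  ultimately show ?case using Suc by (simp add: algebra_simps)
qed simp

text \<open>The weight is at most \<open>N ^ (m + 1)\<close>, the remainder of order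
  \<open>1 / N ^ (m + 2)\<close>. In the boundary term, \<open>ln (N + x)\<close> may thus be
  replaced by \<open>ln N\<close> and a polynomial.\<close>

lemma correction_tendsto_0:
  fixes x :: real
  assumes "x > 0"
  shows "(\<lambda>N. real ((m + N) choose Suc m) * (ln (1 + x / real N) + wexp m (x / real N))) \<longlonglongrightarrow> 0"
proof (rule Lim_null_comparison)
  show "\<forall>\<^sub>F N in sequentially. norm (real ((m + N) choose Suc m) * (ln (1 + x / real N) + wexp m (x / real N)))
      \<le> 2 * x ^ (m + 2) * (1 / real N)"
    using eventually_gt_at_top[of 0] eventually_ge_at_top[of "nat \<lceil>2 * x\<rceil>"]
  proof eventually_elim
    case (elim N)
    define u where "u = x / real N"
    have N: "real N \<ge> 2 * x" "real N > 0" using elim by linarith+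
    have u: "u > 0" "u \<le> 1/2" using N assms by (auto simp: u_def field_simps)
    have "Ln (1 + complex_of_real u) = of_real (ln (1 + u))"
      using Ln_of_real[of "1 + u"] u by simp
    hence "norm (ln (1 + u) + wexp m u) = norm (ln (1 + complex_of_real u) + wexp m (complex_of_real u))"
      by (simp add: wexp_of_real flip: of_real_add)
    also have "\<dots> \<le> 2 * norm (complex_of_real u) ^ (m + 2)"
      by (rule norm_Ln_plus_wexp_le) (use u in simp)
    finally have le: "norm (ln (1 + u) + wexp m u) \<le> 2 * u ^ (m + 2)" using u by simp
    \<comment> \<open>Turns \<open>m + N\<close> into \<open>Suc m + N'\<close>, the shape of
      \<open>binomial_add_le_power\<close>.\<close>
    obtain N' where N': "N = Suc N'" using elim by (cases N) auto
    have "real ((m + N) choose Suc m) \<le> real (N ^ Suc m)"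
      using binomial_add_le_power[of "Suc m" N'] unfolding N' by (intro of_nat_mono) simp
    hence "norm (real ((m + N) choose Suc m) * (ln (1 + u) + wexp m u)) \<le> real N ^ Suc m * (2 * u ^ (m + 2))"
      unfolding norm_mult by (intro mult_mono le) auto
    also have "\<dots> = 2 * x ^ (m + 2) * (1 / real N)"
      using N by (simp add: u_def power_divide field_simps)
    finally show ?case by (simp only: u_def)
  qed
  show "(\<lambda>N. 2 * x ^ (m + 2) * (1 / real N)) \<longlonglongrightarrow> 0" by real_asymp
qed

text \<open>Summation by parts cancels all logarithms up to a boundary term that is itself
  polynomial up to \<open>o(1)\<close>; hence the difference is a pointwise limit of polynomials of
  bounded degree.\<close>

lemma wlog_difference_poly:
  "\<exists>q. degree q \<le> Suc m \<and>
     (\<forall>x>0. wlog (Suc m) (x - 1) - wlog (Suc m) x - wlog m (x - 1) = poly q (x::real))"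
proof -
  define S where "S = (\<lambda>N x. \<Sum>k<N. glog (Suc m) k (x - 1) - glog (Suc m) k x - glog m k (x - 1 :: real))"
  define sh where "sh = (\<lambda>p :: real poly. pcompose p [:-1, 1:])"
  define C where "C = (\<lambda>m k. real ((m + k) choose m))"
  define D where "D = (\<lambda>N. real ((m + N) choose Suc m))"
  \<comment> \<open>The polynomial part of the \<open>k\<close>-th summand of \<open>S\<close>; the
    constants \<open>ln (Suc k)\<close> with weight \<open>C (Suc m) k\<close> have
    cancelled.\<close>
  define r where "r = (\<lambda>k. [:C m k * ln (real (Suc k)):] +
      smult (C (Suc m) k) (sh (wpoly (Suc m) (1 / real (Suc k))) - wpoly (Suc m) (1 / real (Suc k)))
      - smult (C m k) (sh (wpoly m (1 / real (Suc k)))))"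
  \<comment> \<open>The polynomial parts together with the boundary term, in which
    \<open>ln (1 + x / N)\<close> is replaced by \<open>- wexp m (x / N)\<close>.\<close>
  define p where "p = (\<lambda>N. (\<Sum>k<N. r k) - [:D N * ln (real N):] + smult (D N) (wpoly m (1 / real N)))"
  have deg_r: "degree (r k) \<le> Suc m" for k
  proof -
    have "degree (sh (wpoly (Suc m) (1 / real (Suc k))) - wpoly (Suc m) (1 / real (Suc k))) \<le> Suc m"
      unfolding sh_def by (rule degree_pcompose_shift_diff[OF degree_wpoly])
    moreover have "degree (sh (wpoly m (1 / real (Suc k)))) \<le> Suc m"
      unfolding sh_def using degree_wpoly[of m "1 / real (Suc k)"] by (simp add: degree_pcompose del: of_nat_Suc)
    ultimately show ?thesis
      unfolding r_def
      by (intro degree_add_le degree_diff_le[of "_ + _"] order_trans[OF degree_smult_le]) simp_all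
  qed
  have deg_p: "degree (p N) \<le> Suc m" for N
    unfolding p_def
    by (intro degree_add_le degree_diff_le degree_sum_le order_trans[OF degree_smult_le] degree_wpoly deg_r) simp_all
  have summand: "glog (Suc m) k (x - 1) - glog (Suc m) k x - glog m k (x - 1) =
      (C (Suc m) k * ln (real (Suc k) + (x - 1)) - C (Suc m) k * ln (real (Suc k) + x)
        - C m k * ln (real (Suc k) + (x - 1))) + poly (r k) x" if "x > 0" for k and x :: real
    using that
    by (simp add: glog_real_split r_def sh_def poly_pcompose C_def algebra_simps del: of_nat_Suc binomial_Suc_Suc add_Suc)
  have poly_p: "poly (p N) x = S N x + D N * (ln (1 + x / real N) + wexp m (x / real N))"
    if x: "x > 0" and N: "N > 0" for N and x :: real
  proof -
    have "1 + x / real N = (real N + x) / real N" using N by (simp add: field_simps)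
    hence ln: "ln (1 + x / real N) = ln (real N + x) - ln (real N)"
      using x N by (simp add: ln_div)
    have "S N x = - (D N * ln (real N + x)) + (\<Sum>k<N. poly (r k) x)"
      unfolding S_def summand[OF x] sum.distrib C_def binomial_sum_by_parts D_def ..
    thus ?thesis unfolding p_def ln
      by (simp add: poly_sum poly_wpoly algebra_simps)
  qed
  have lim: "(\<lambda>N. poly (p N) x) \<longlonglongrightarrow> wlog (Suc m) (x - 1) - wlog (Suc m) x - wlog m (x - 1)"
    if "x \<in> {0<..}" for x
  proof (rule Lim_transform_eventually)
    have x: "x > 0" using that by simp
    have "(\<lambda>k. glog (Suc m) k (x - 1) - glog (Suc m) k x - glog m k (x - 1)) sums
       (wlog (Suc m) (x - 1) - wlog (Suc m) x - wlog m (x - 1))"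
      using x by (intro sums_diff glog_sums_real) auto
    hence "(\<lambda>N. S N x) \<longlonglongrightarrow> wlog (Suc m) (x - 1) - wlog (Suc m) x - wlog m (x - 1)"
      by (simp only: S_def sums_def)
    from tendsto_add[OF this correction_tendsto_0[OF x, of m]]
    show "(\<lambda>N. S N x + D N * (ln (1 + x / real N) + wexp m (x / real N))) \<longlonglongrightarrow>
       wlog (Suc m) (x - 1) - wlog (Suc m) x - wlog m (x - 1)"
      unfolding D_def by simp
    show "\<forall>\<^sub>F N in sequentially. S N x + D N * (ln (1 + x / real N) + wexp m (x / real N)) = poly (p N) x"
      using eventually_gt_at_top[of 0] by eventually_elim (simp add: poly_p[OF x])
  qed
  have "infinite {0::real<..}" by (rule infinite_Ioi)
  from poly_pointwise_limit[OF deg_p this lim] show ?thesis by auto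
qed

section \<open>Correction polynomials and the reciprocal Gamma functions\<close>

lemma correction_polys_exist:
  "\<exists>P :: nat \<Rightarrow> real poly. P 0 = [:0, euler_mascheroni:] \<and>
     (\<forall>m. degree (P m) \<le> Suc m \<and> poly (P m) 0 = 0 \<and>
       (\<forall>x>0. (poly (P (Suc m)) x + wlog (Suc m) x) + (poly (P m) (x - 1) + wlog m (x - 1)) =
          poly (P (Suc m)) (x - 1) + wlog (Suc m) (x - 1)))"
proof -
  define Q where "Q = (\<lambda>m (p::real poly). degree p \<le> Suc m \<and> poly p 0 = 0)"
  define R where "R = (\<lambda>m (p::real poly) q. \<forall>x>0. (poly q x + wlog (Suc m) x) + (poly p (x - 1) + wlog m (x - 1)) =
          poly q (x - 1) + wlog (Suc m) (x - 1))"
  have "\<exists>P. (\<forall>m. Q m (P m) \<and> (m = 0 \<longrightarrow> P m = [:0, euler_mascheroni:])) \<and> (\<forall>m. R m (P m) (P (Suc m)))"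
  proof -
    \<comment> \<open>The starting value is carried in the index-dependent invariant as a condition
      at \<open>m = 0\<close>.\<close>
    have "\<exists>P. \<forall>m. (Q m (P m) \<and> (m = 0 \<longrightarrow> P m = [:0, euler_mascheroni:])) \<and> R m (P m) (P (Suc m))"
    proof (rule dependent_nat_choice)
      show "\<exists>p. Q 0 p \<and> (0 = (0::nat) \<longrightarrow> p = [:0, euler_mascheroni:])"
        by (auto simp: Q_def)
    next
      fix p m assume p: "Q m p \<and> (m = 0 \<longrightarrow> p = [:0, euler_mascheroni:])"
      obtain d where d: "degree d \<le> Suc m"
        "\<And>x::real. x > 0 \<Longrightarrow> wlog (Suc m) (x - 1) - wlog (Suc m) x - wlog m (x - 1) = poly d x"
        using wlog_difference_poly[of m] by blast
      \<comment> \<open>The relation \<open>R m p q\<close> amounts to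
        \<open>q(x) - q(x - 1) = d(x) - p(x - 1)\<close>, so \<open>q\<close> is an antidifference
        of this polynomial.\<close>
      have "degree (d - pcompose p [:-1, 1:]) \<le> Suc m"
        using p d(1) by (intro degree_diff_le) (simp_all add: Q_def degree_pcompose)
      from poly_antidifference[OF this] obtain q where q: "degree q \<le> Suc (Suc m)" "poly q 0 = 0"
        "\<And>x. poly q x - poly q (x - 1) = poly (d - pcompose p [:-1, 1:]) x" by blast
      have "R m p q" unfolding R_def
      proof (intro allI impI)
        fix x :: real assume "x > 0"
        thus "(poly q x + wlog (Suc m) x) + (poly p (x - 1) + wlog m (x - 1)) = poly q (x - 1) + wlog (Suc m) (x - 1)"
          using q(3)[of x] d(2)[of x] by (simp add: poly_pcompose)
      qed
      with q show "\<exists>q. (Q (Suc m) q \<and> (Suc m = 0 \<longrightarrow> q = [:0, euler_mascheroni:])) \<and> R m p q"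
        by (auto simp: Q_def)
    qed
    thus ?thesis by blast
  qed
  thus ?thesis unfolding Q_def R_def by blast
qed

definition gpoly :: "nat \<Rightarrow> real poly" where
  "gpoly = (SOME P. P 0 = [:0, euler_mascheroni:] \<and>
     (\<forall>m. degree (P m) \<le> Suc m \<and> poly (P m) 0 = 0 \<and>
       (\<forall>x>0. (poly (P (Suc m)) x + wlog (Suc m) x) + (poly (P m) (x - 1) + wlog m (x - 1)) =
          poly (P (Suc m)) (x - 1) + wlog (Suc m) (x - 1))))"

text \<open>The recurrence is the functional equation for the indices \<open>m + 2\<close> and
  \<open>m + 1\<close>, in logarithms of reciprocals; vanishing at 0 encodes the value 1 at
  1.\<close>

lemma
  shows gpoly_0: "gpoly 0 = [:0, euler_mascheroni:]"
    and degree_gpoly: "degree (gpoly m) \<le> Suc m"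
    and poly_gpoly_0: "poly (gpoly m) 0 = 0"
    and gpoly_wlog_recurrence: "x > 0 \<Longrightarrow>
      (poly (gpoly (Suc m)) x + wlog (Suc m) x) + (poly (gpoly m) (x - 1) + wlog m (x - 1)) =
          poly (gpoly (Suc m)) (x - 1) + wlog (Suc m) (x - 1)"
  using someI_ex[OF correction_polys_exist] unfolding gpoly_def[symmetric] by blast+

definition cpoly :: "nat \<Rightarrow> complex poly" where
  "cpoly m = map_poly of_real (gpoly m)"

lemma poly_cpoly_of_real: "poly (cpoly m) (of_real x) = of_real (poly (gpoly m) x)"
proof -
  have "poly (map_poly of_real p) (of_real x) = complex_of_real (poly p x)" for p :: "real poly"
    by (induction p) (simp_all add: map_poly_pCons)
  thus ?thesis by (simp add: cpoly_def)
qed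

lemma degree_cpoly: "degree (cpoly m) \<le> Suc m"
  using degree_gpoly[of m] map_poly_degree_leq[of complex_of_real "gpoly m"] by (simp add: cpoly_def)

text \<open>This is \<open>1 / \<Gamma>\<^bsub>m+1\<^esub>(1 + z)\<close>.\<close>

definition rmgamma :: "nat \<Rightarrow> complex \<Rightarrow> complex" where
  "rmgamma m z = exp (poly (cpoly m) z) * wprod m z"

lemma rmgamma_holomorphic: "rmgamma m holomorphic_on A"
  unfolding rmgamma_def by (intro holomorphic_intros wprod_holomorphic)

lemma Re_gt_imp_not_neg_Suc: "Re z > -1 \<Longrightarrow> z \<noteq> - of_nat (Suc k)"
  by auto

lemma exp_wlog_Re: "Re z > -1 \<Longrightarrow> exp (wlog m z) = wprod m z"
  by (intro exp_wlog Re_gt_imp_not_neg_Suc)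

lemma rmgamma_eq_exp:
  "Re z > -1 \<Longrightarrow> rmgamma m z = exp (poly (cpoly m) z + wlog m z)"
  by (simp add: rmgamma_def exp_add exp_wlog_Re)

lemma rmgamma_of_real:
  "x > -1 \<Longrightarrow> rmgamma m (of_real x) = of_real (exp (poly (gpoly m) x + wlog m x))"
  by (subst rmgamma_eq_exp) (simp_all add: poly_cpoly_of_real wlog_of_real exp_of_real flip: of_real_add)

lemma rmgamma_at_0: "rmgamma m 0 = 1"
proof -
  have "glog m k (0::real) = 0" for k
    by (simp add: glog_def)
  hence "wlog m (0::real) = 0" by (simp add: wlog_def)
  thus ?thesis using rmgamma_of_real[of 0 m] by (simp add: poly_gpoly_0)
qed

text \<open>Identity theorem: the positive reals accumulate at 1.\<close>

lemma entire_eqI_pos_reals: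
  assumes "f holomorphic_on UNIV" "g holomorphic_on UNIV"
    and "\<And>x. x > 0 \<Longrightarrow> f (complex_of_real x) = g (of_real x)"
  shows "f z = g z"
proof -
  have "1 islimpt complex_of_real ` {0<..}"
    unfolding islimpt_approachable
  proof (intro allI impI)
    fix e :: real assume e: "e > 0"
    hence "complex_of_real (1 + e / 2) \<in> complex_of_real ` {0<..}" by (intro imageI) simp
    moreover have "complex_of_real (1 + e / 2) \<noteq> 1" "dist (complex_of_real (1 + e / 2)) 1 < e"
      using e by (simp_all add: dist_norm)
    ultimately show "\<exists>w\<in>complex_of_real ` {0<..}. w \<noteq> 1 \<and> dist w 1 < e" by blast
  qed
  moreover have "(\<lambda>z. f z - g z) holomorphic_on UNIV"
    by (intro holomorphic_on_diff assms)
  ultimately have "f z - g z = 0"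
    by (elim analytic_continuation) (use assms(3) in auto)
  thus ?thesis by simp
qed

text \<open>On the positive reals this is the exponential of \<open>gpoly_wlog_recurrence\<close>.
  Reciprocals have no poles, so the identity extends as one of entire functions.\<close>

lemma rmgamma_recurrence:
  "rmgamma (Suc m) z * rmgamma m (z - 1) = rmgamma (Suc m) (z - 1)"
proof (rule entire_eqI_pos_reals[where f = "\<lambda>z. rmgamma (Suc m) z * rmgamma m (z - 1)"])
  have hol: "(\<lambda>z. rmgamma m (z - 1)) holomorphic_on UNIV" for m
    by (intro holomorphic_on_compose[of "\<lambda>z. z - 1" UNIV "rmgamma m", unfolded o_def]
          holomorphic_intros rmgamma_holomorphic)
  thus "(\<lambda>z. rmgamma (Suc m) z * rmgamma m (z - 1)) holomorphic_on UNIV"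
    "(\<lambda>z. rmgamma (Suc m) (z - 1)) holomorphic_on UNIV"
    by (auto intro: holomorphic_intros rmgamma_holomorphic)
  fix x :: real assume x: "x > 0"
  have "rmgamma m (of_real x - 1) = rmgamma m (of_real (x - 1))" for m by simp
  thus "rmgamma (Suc m) (of_real x) * rmgamma m (of_real x - 1) = rmgamma (Suc m) (of_real x - 1)"
    using x by (simp only: rmgamma_of_real gpoly_wlog_recurrence[symmetric])
       (simp add: rmgamma_of_real exp_add gpoly_wlog_recurrence[symmetric])
qed

text \<open>Euler's constant in \<open>gpoly 0\<close> matches the Weierstrass product of
  \<open>rGamma\<close>. Dividing that product by \<open>z\<close> shifts the argument to
  \<open>1 + z\<close>, so \<open>z = 0\<close> is treated apart.\<close>

lemma rmgamma_0: "rmgamma 0 z = rGamma (1 + z)"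
proof (rule LIMSEQ_unique)
  have "(\<lambda>N. exp (poly (cpoly 0) z) * (\<Prod>k<N. gfac 0 k z)) \<longlonglongrightarrow> rmgamma 0 z"
    unfolding rmgamma_def by (intro tendsto_mult tendsto_const gfac_LIMSEQ)
  moreover have "poly (cpoly 0) z = euler_mascheroni * z"
    by (simp add: cpoly_def gpoly_0 map_poly_pCons)
  ultimately show "(\<lambda>N. exp (euler_mascheroni * z) * (\<Prod>k<N. gfac 0 k z)) \<longlonglongrightarrow> rmgamma 0 z"
    by simp
  have eq: "(\<Prod>k<N. gfac 0 k z) = (\<Prod>k=1..N. (1 + z / of_nat k) * exp (- z / of_nat k))" for N
  proof -
    have "(\<Prod>k=1..N. (1 + z / of_nat k) * exp (- z / of_nat k)) =
       (\<Prod>k<N. (1 + z / of_nat (Suc k)) * exp (- z / of_nat (Suc k)))"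
      by (rule prod.reindex_bij_witness[of _ Suc "\<lambda>k. k - 1"]) auto
    thus ?thesis by (simp add: gfac_def wexp_def)
  qed
  show "(\<lambda>N. exp (euler_mascheroni * z) * (\<Prod>k<N. gfac 0 k z)) \<longlonglongrightarrow> rGamma (1 + z)"
  proof (cases "z = 0")
    case True
    thus ?thesis by (simp add: gfac_def)
  next
    case False
    have "(\<lambda>N. rGamma_series_Weierstrass z N / z) \<longlonglongrightarrow> rGamma z / z"
      using False by (intro tendsto_intros rGamma_Weierstrass_complex)
    moreover have "rGamma z / z = rGamma (1 + z)"
      using rGamma_plus1[of z] False by (simp add: add.commute field_simps)
    ultimately show ?thesis using False
      by (simp add: eq rGamma_series_Weierstrass_def mult_ac)
  qed
qed

subsection \<open>Solutions of the difference equation on the positive reals\<close>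

lemma has_real_derivative_Re_of_real:
  assumes "(F has_field_derivative D) (at (complex_of_real x))"
  shows "((\<lambda>x. Re (F (of_real x))) has_real_derivative Re D) (at x)"
proof -
  have "((\<lambda>x. F (of_real x)) has_vector_derivative D) (at x)"
    by (rule has_vector_derivative_real_field[OF assms])
  from bounded_linear.has_vector_derivative[OF bounded_linear_Re this]
  show ?thesis by (simp add: has_real_derivative_iff_has_vector_derivative)
qed

text \<open>Along the positive axis, differentiation commutes with taking real parts; agreement of
  \<open>f\<close> with \<open>Re F\<close> there suffices because \<open>deriv\<close> is
  local.\<close>

lemma higher_deriv_Re_of_real:
  assumes F: "F holomorphic_on S" "open S" "\<And>x. x > 0 \<Longrightarrow> complex_of_real x \<in> S"
    and f: "\<And>x. x > 0 \<Longrightarrow> f x = Re (F (of_real x))"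
    and x: "x > 0"
  shows "(deriv ^^ j) f x = Re ((deriv ^^ j) F (of_real x))"
proof -
  define g where "g = (\<lambda>j x. Re ((deriv ^^ j) F (of_real x)))"
  have "eventually (\<lambda>y. f y = g 0 y) (nhds x)"
    using eventually_nhds_in_open[of "{0<..}" x] x
    by (auto elim!: eventually_mono simp: f g_def)
  hence "(deriv ^^ j) f x = (deriv ^^ j) (g 0) x"
    by (rule higher_deriv_cong_ev) simp
  also have "\<dots> = g j x"
  proof (rule higher_deriv_chain[where S = "{0<..}"])
    fix j y assume "y \<in> {0::real<..}"
    hence "((deriv ^^ j) F has_field_derivative (deriv ^^ Suc j) F (of_real y)) (at (of_real y))"
      by (intro has_field_derivative_higher_deriv[OF F(1,2)] F(3)) auto
    thus "(g j has_field_derivative g (Suc j) y) (at y)"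
      unfolding g_def by (rule has_real_derivative_Re_of_real)
  qed (use x in auto)
  finally show ?thesis by (simp add: g_def)
qed

lemma higher_deriv_Re_of_real_smooth:
  assumes F: "F holomorphic_on S" "open S" "\<And>x. x > 0 \<Longrightarrow> complex_of_real x \<in> S"
    and f: "\<And>x. x > 0 \<Longrightarrow> f x = Re (F (of_real x))"
    and x: "x > 0"
  shows "((deriv ^^ j) f has_real_derivative (deriv ^^ Suc j) f x) (at x)"
proof -
  have "((deriv ^^ j) F has_field_derivative (deriv ^^ Suc j) F (of_real x)) (at (of_real x))"
    using x by (intro has_field_derivative_higher_deriv[OF F(1,2)] F(3)) auto
  hence "((\<lambda>x. Re ((deriv ^^ j) F (of_real x))) has_real_derivative Re ((deriv ^^ Suc j) F (of_real x))) (at x)"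
    by (rule has_real_derivative_Re_of_real)
  hence "((\<lambda>x. Re ((deriv ^^ j) F (of_real x))) has_real_derivative (deriv ^^ Suc j) f x) (at x)"
    by (simp only: higher_deriv_Re_of_real[OF assms])
  thus ?thesis
  proof (rule has_field_derivative_transform_within_open)
    fix y :: real assume "y \<in> {0<..}"
    thus "Re ((deriv ^^ j) F (of_real y)) = (deriv ^^ j) f y"
      by (intro higher_deriv_Re_of_real[OF F f, symmetric]) auto
  qed (use x in auto)
qed

text \<open>A nonzero value rules out a pole, where the value is 0 by convention.\<close>

lemma nicely_meromorphic_on_tendsto:
  assumes "f nicely_meromorphic_on A" "z \<in> A" "f z \<noteq> 0"
  shows "f \<midarrow>z\<rightarrow> f z"
  using assms by (auto simp: nicely_meromorphic_on_def)

text \<open>Poles carry the value 0, so positivity keeps them off the positive axis. Hence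
  \<open>G\<close> and its principal logarithm are holomorphic near that axis.\<close>

lemma nicely_meromorphic_ln_smooth:
  assumes G: "G nicely_meromorphic_on UNIV"
    and pos: "\<And>x. x > 0 \<Longrightarrow> G (complex_of_real x) \<in> \<real> \<and> Re (G (of_real x)) > 0"
    and x: "x > 0"
  shows "((deriv ^^ j) (\<lambda>t. ln (Re (G (complex_of_real t)))) has_real_derivative
           (deriv ^^ Suc j) (\<lambda>t. ln (Re (G (complex_of_real t)))) x) (at x)"
proof -
  have nz: "G (complex_of_real y) \<noteq> 0" if "y > 0" for y using pos[OF that] by auto
  obtain pts where pts: "G analytic_on UNIV - pts" "\<And>z. z \<in> pts \<Longrightarrow> G z = 0"
    using nicely_meromorphic_onE[OF G] by metis
  have "G analytic_on complex_of_real ` {0<..}"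
    by (rule analytic_on_subset[OF pts(1)]) (use nz pts(2) in auto)
  then obtain T where T: "open T" "complex_of_real ` {0<..} \<subseteq> T" "G holomorphic_on T"
    unfolding analytic_on_holomorphic by blast
  \<comment> \<open>Removing the preimage of the branch cut makes \<open>ln (G z)\<close>
    holomorphic.\<close>
  define U where "U = T \<inter> G -` (- \<real>\<^sub>\<le>\<^sub>0)"
  have "open U" unfolding U_def
    by (intro continuous_open_preimage holomorphic_on_imp_continuous_on T open_Compl closed_nonpos_Reals_complex)
  have inU: "complex_of_real y \<in> U" if "y > 0" for y
    using T(2) that pos[OF that] by (auto simp: U_def complex_nonpos_Reals_iff)
  have hol: "(\<lambda>z. ln (G z)) holomorphic_on U"
    by (intro holomorphic_intros holomorphic_on_subset[OF T(3)]) (auto simp: U_def)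
  have "ln (Re (G (of_real y))) = Re (ln (G (of_real y)))" if "y > 0" for y
  proof -
    have "G (of_real y) = of_real (Re (G (of_real y)))" using pos[OF that] by simp
    thus ?thesis using pos[OF that] by (metis Ln_of_real Re_complex_of_real)
  qed
  from higher_deriv_Re_of_real_smooth[OF hol \<open>open U\<close> inU this x]
  show ?thesis by simp
qed

text \<open>Enough periods carry \<open>x\<close> beyond \<open>y\<close>, so monotonicity gives
  \<open>p y \<le> p x\<close> for every pair of positive arguments.\<close>

lemma periodic_nondecreasing_const:
  fixes p :: "real \<Rightarrow> real"
  assumes per: "\<And>x. x > 0 \<Longrightarrow> p (x + 1) = p x"
    and deriv: "\<And>x. x > 0 \<Longrightarrow> (p has_real_derivative p' x) (at x)"
    and nonneg: "\<And>x. x > 0 \<Longrightarrow> p' x \<ge> 0"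
    and xy: "x > 0" "y > 0"
  shows "p x = p y"
proof -
  have per': "p (x + real n) = p x" if "x > 0" for x n
  proof (induction n)
    case (Suc n)
    have "p (x + real (Suc n)) = p ((x + real n) + 1)" by (simp add: add_ac)
    thus ?case using that per[of "x + real n"] Suc by simp
  qed simp
  have mono: "p x \<le> p y" if "0 < x" "x \<le> y" for x y
    using that deriv nonneg by (intro DERIV_nonneg_imp_nondecreasing[OF \<open>x \<le> y\<close>]) (metis order_less_le_trans)
  have le: "p y \<le> p x" if "x > 0" "y > 0" for x y
  proof -
    have "y \<le> x + real (nat \<lceil>y\<rceil>)" using that by linarith
    from mono[OF \<open>y > 0\<close> this] show ?thesis by (simp add: per'[OF \<open>x > 0\<close>])
  qed
  show ?thesis using le[of x y] le[of y x] xy by simp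
qed

text \<open>The difference of two solutions of the same difference equation is periodic, so a
  one-sided asymptotic bound on a high derivative holds everywhere; a periodic function with
  a derivative of constant sign is constant, and this descends to the difference itself.\<close>

lemma difference_equation_unique:
  fixes f g :: "real \<Rightarrow> real" and \<sigma> :: real
  assumes f: "\<And>j x. x > 0 \<Longrightarrow> ((deriv ^^ j) f has_real_derivative (deriv ^^ Suc j) f x) (at x)"
    and g: "\<And>j x. x > 0 \<Longrightarrow> ((deriv ^^ j) g has_real_derivative (deriv ^^ Suc j) g x) (at x)"
    and diff: "\<And>x. x > 0 \<Longrightarrow> f (x + 1) - f x = g (x + 1) - g x"
    and sign_f: "\<And>x. x > 0 \<Longrightarrow> \<sigma> * (deriv ^^ Suc N) f x \<ge> 0"
    and bound_g: "\<And>x. x > 0 \<Longrightarrow> (\<lambda>n. \<sigma> * (deriv ^^ Suc N) g (x + real n)) \<longlonglongrightarrow> 0"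
    and \<sigma>: "\<sigma> \<noteq> 0"
    and "x > 0" "y > 0"
  shows "f x - g x = f y - g y"
proof -
  define h where "h = (\<lambda>j x. (deriv ^^ j) f x - (deriv ^^ j) g x)"
  have der: "(h j has_real_derivative h (Suc j) x) (at x)" if "x > 0" for j x
    unfolding h_def by (intro DERIV_diff f g that)
  have per: "x > 0 \<Longrightarrow> h j (x + 1) = h j x" for j x
  proof (induction j arbitrary: x)
    case 0
    thus ?case using diff[of x] by (simp add: h_def)
  next
    case (Suc j)
    have "((\<lambda>x. h j (x + 1)) has_real_derivative h (Suc j) (x + 1)) (at x)"
      using der[of "x + 1" j] Suc.prems by (simp add: DERIV_shift)
    hence "(h j has_real_derivative h (Suc j) (x + 1)) (at x)"
      by (rule has_field_derivative_transform_within_open[where S = "{0<..}"])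
         (use Suc in auto)
    from DERIV_unique[OF this der[OF Suc.prems]] show ?case .
  qed
  have per': "h j (x + real n) = h j x" if "x > 0" for j x n
  proof (induction n)
    case (Suc n)
    have "h j (x + real (Suc n)) = h j ((x + real n) + 1)" by (simp add: add_ac)
    thus ?case using that per[of "x + real n" j] Suc by simp
  qed simp
  \<comment> \<open>By periodicity the value at \<open>x\<close> is also that at
    \<open>x + n\<close>. Dropping the nonnegative contribution of \<open>f\<close> leaves a lower
    bound that tends to 0.\<close>
  have nonneg: "\<sigma> * h (Suc N) x \<ge> 0" if "x > 0" for x
  proof (rule LIMSEQ_le_const2)
    show "(\<lambda>n. - (\<sigma> * (deriv ^^ Suc N) g (x + real n))) \<longlonglongrightarrow> 0"
      using tendsto_minus[OF bound_g[OF that]] by simp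
    show "\<exists>M. \<forall>n\<ge>M. - (\<sigma> * (deriv ^^ Suc N) g (x + real n)) \<le> \<sigma> * h (Suc N) x"
    proof (intro exI allI impI)
      fix n
      have "- (\<sigma> * (deriv ^^ Suc N) g (x + real n)) \<le> \<sigma> * h (Suc N) (x + real n)"
        using sign_f[of "x + real n"] that unfolding h_def right_diff_distrib by simp
      thus "- (\<sigma> * (deriv ^^ Suc N) g (x + real n)) \<le> \<sigma> * h (Suc N) x"
        by (simp only: per'[OF that])
    qed
  qed
  have step: "h j x = h j y" if "\<tau> \<noteq> 0" "\<And>x. x > 0 \<Longrightarrow> \<tau> * h (Suc j) x \<ge> 0" "x > 0" "y > 0" for j x y \<tau>
  proof -
    have "\<tau> * h j x = \<tau> * h j y"
      by (rule periodic_nondecreasing_const[where p' = "\<lambda>x. \<tau> * h (Suc j) x"])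
         (use that der per in \<open>auto intro: DERIV_cmult\<close>)
    thus ?thesis using that by simp
  qed
  have "\<forall>x>0. \<forall>y>0. h 0 x = h 0 y"
  proof (rule inc_induct[of 0 N])
    show "\<forall>x>0. \<forall>y>0. h N x = h N y"
      using step[OF \<sigma> nonneg] by blast
  next
    fix j assume c: "\<forall>x>0. \<forall>y>0. h (Suc j) x = h (Suc j) y"
    \<comment> \<open>A sign that makes the constant \<open>h (Suc j)\<close> nonnegative, so that
      \<open>step\<close> applies one order lower.\<close>
    define \<tau> where "\<tau> = (if h (Suc j) 1 \<ge> 0 then 1 else -1 :: real)"
    have "\<tau> * h (Suc j) x \<ge> 0" if "x > 0" for x
    proof -
      have "h (Suc j) x = h (Suc j) 1" using c that zero_less_one by blast
      thus ?thesis by (simp add: \<tau>_def)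
    qed
    moreover have "\<tau> \<noteq> 0" by (simp add: \<tau>_def)
    ultimately show "\<forall>x>0. \<forall>y>0. h j x = h j y" using step by blast
  qed simp
  hence "h 0 x = h 0 y" using \<open>x > 0\<close> \<open>y > 0\<close> by blast
  thus ?thesis by (simp add: h_def)
qed

subsection \<open>The multiple Gamma functions\<close>

text \<open>The convention \<open>inverse 0 = 0\<close> supplies the value 0 at the poles that the
  normalisation demands.\<close>

definition mgamma :: "nat \<Rightarrow> complex \<Rightarrow> complex" where
  "mgamma n z = inverse (rmgamma (n - 1) (z - 1))"

lemma rmgamma_shift_holomorphic: "(\<lambda>z. rmgamma m (z - 1)) holomorphic_on A"
  by (intro holomorphic_on_compose[of "\<lambda>z. z - 1" A "rmgamma m", unfolded o_def]
        holomorphic_intros rmgamma_holomorphic)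

lemma mgamma_nicely_meromorphic: "mgamma n nicely_meromorphic_on UNIV"
  unfolding mgamma_def
  by (intro nicely_meromorphic_on_inverse analytic_on_imp_nicely_meromorphic_on)
     (simp add: analytic_on_open rmgamma_shift_holomorphic)

lemma mgamma_1: "mgamma 1 = Gamma"
  by (rule ext) (simp add: mgamma_def rmgamma_0 Gamma_def)

lemma mgamma_at_1: "mgamma n 1 = 1"
  by (simp add: mgamma_def rmgamma_at_0)

text \<open>The function is not identically 0, its value at 1 being 1, so its zeros are
  sparse.\<close>

lemma rmgamma_shift_nonzero: "\<forall>\<^sub>\<approx>z. rmgamma m (z - 1) \<noteq> 0"
proof -
  have "(\<lambda>z. rmgamma m (z - 1)) nicely_meromorphic_on UNIV"
    by (intro analytic_on_imp_nicely_meromorphic_on)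
       (simp add: analytic_on_open rmgamma_shift_holomorphic)
  from nicely_meromorphic_imp_constant_or_avoid[OF this, of 0]
  have "(\<forall>z. rmgamma m (z - 1) = 0) \<or> (\<forall>\<^sub>\<approx>z. rmgamma m (z - 1) \<noteq> 0)"
    by (simp add: connected_UNIV)
  moreover have "rmgamma m (1 - 1) \<noteq> 0" by (simp add: rmgamma_at_0)
  ultimately show ?thesis by blast
qed

text \<open>Invert \<open>rmgamma_recurrence\<close>; cancelling is possible away from the zeros of
  \<open>rmgamma m (z - 1)\<close>.\<close>

lemma mgamma_functional_equation:
  assumes "n \<ge> 1"
  shows "\<forall>\<^sub>\<approx>z. mgamma (n + 1) (z + 1) = mgamma (n + 1) z / mgamma n z"
proof -
  obtain m where n: "n = Suc m" using assms by (cases n) auto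
  show ?thesis
    using rmgamma_shift_nonzero[of m]
  proof eventually_elim
    case (elim z)
    thus ?case by (simp add: mgamma_def n rmgamma_recurrence[of m z, symmetric])
  qed
qed

lemma mgamma_of_real:
  assumes "x > 0"
  shows "mgamma (Suc m) (of_real x) = of_real (exp (- (poly (gpoly m) (x - 1) + wlog m (x - 1))))"
proof -
  have "rmgamma m (of_real (x - 1)) = of_real (exp (poly (gpoly m) (x - 1) + wlog m (x - 1)))"
    using assms by (intro rmgamma_of_real) simp
  thus ?thesis by (simp only: mgamma_def exp_minus) simp
qed

lemma mgamma_real_pos:
  assumes "n \<ge> 1" "x > 0"
  shows "mgamma n (of_real x) \<in> \<real> \<and> Re (mgamma n (of_real x)) > 0"
proof -
  obtain m where n: "n = Suc m" using assms by (cases n) auto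
  show ?thesis using assms(2) by (simp add: n mgamma_of_real)
qed

text \<open>The polynomial disappears after \<open>m + 2\<close> derivatives. The minus sign of the
  reciprocal and the sign from \<open>higher_deriv_wlog\<close> combine with the prefactor to
  \<open>+1\<close>.\<close>

lemma higher_deriv_ln_mgamma:
  assumes x: "x > 0"
  obtains s where "s \<ge> 0" "x > 1 \<Longrightarrow> s \<le> 1 / (x - 1)"
    "(-1) ^ (m + 2) * (deriv ^^ (m + 2)) (\<lambda>t. ln (Re (mgamma (Suc m) (complex_of_real t)))) x = fact (m + 1) * s"
proof -
  \<comment> \<open>The successive derivatives of a logarithm of \<open>mgamma (Suc m)\<close> on
    the right half-plane.\<close>
  define f where "f = (\<lambda>j z. - (poly ((pderiv ^^ j) (cpoly m)) (z - 1) + (deriv ^^ j) (wlog m) (z - 1)))"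
  define S where "S = {z. Re z > 0}"
  have "open S" unfolding S_def by (rule open_halfspace_Re_gt)
  have der: "(f j has_field_derivative f (Suc j) z) (at z)" if "z \<in> S" for j z
  proof -
    have "((deriv ^^ j) (wlog m) has_field_derivative (deriv ^^ Suc j) (wlog m) (z - 1)) (at (z - 1))"
      using that by (intro has_field_derivative_higher_deriv[OF wlog_holomorphic open_halfspace_Re_gt])
        (simp add: S_def)
    from DERIV_add[OF poly_DERIV[of "(pderiv ^^ j) (cpoly m)"] this]
    have "((\<lambda>w. poly ((pderiv ^^ j) (cpoly m)) w + (deriv ^^ j) (wlog m) w) has_field_derivative
       (poly ((pderiv ^^ Suc j) (cpoly m)) (z - 1) + (deriv ^^ Suc j) (wlog m) (z - 1))) (at (z + (-1)))"
      by simp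
    from DERIV_minus[OF this[unfolded DERIV_shift]] show ?thesis by (simp add: f_def)
  qed
  have "f 0 holomorphic_on S"
    using der[of _ 0] by (intro holomorphic_onI) (auto simp: field_differentiable_def intro: has_field_derivative_at_within)
  moreover have "ln (Re (mgamma (Suc m) (complex_of_real t))) = Re (f 0 (of_real t))" if "t > 0" for t
  proof -
    have "f 0 (of_real t) = - (poly (cpoly m) (of_real (t - 1)) + wlog m (of_real (t - 1)))"
      by (simp add: f_def)
    also have "wlog m (complex_of_real (t - 1)) = of_real (wlog m (t - 1))"
      using that by (intro wlog_of_real) simp
    also have "- (poly (cpoly m) (of_real (t - 1)) + of_real (wlog m (t - 1))) =
        complex_of_real (- (poly (gpoly m) (t - 1) + wlog m (t - 1)))"
      by (simp only: poly_cpoly_of_real of_real_minus of_real_add)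
    finally show ?thesis using that by (simp add: mgamma_of_real)
  qed
  ultimately have "(deriv ^^ (m + 2)) (\<lambda>t. ln (Re (mgamma (Suc m) (complex_of_real t)))) x =
      Re ((deriv ^^ (m + 2)) (f 0) (of_real x))"
    by (intro higher_deriv_Re_of_real[OF _ \<open>open S\<close> _ _ x]) (auto simp: S_def)
  also have "(deriv ^^ (m + 2)) (f 0) (of_real x) = f (m + 2) (of_real x)"
    by (rule higher_deriv_chain[where S = S and f = f])
       (use x \<open>open S\<close> der in \<open>auto simp: S_def simp del: funpow.simps\<close>)
  also have "\<dots> = - (deriv ^^ (m + 2)) (wlog m) (of_real (x - 1))"
    using higher_pderiv_eq_0[of "cpoly m" "m + 2"] degree_cpoly[of m] by (simp add: f_def del: funpow.simps)
  finally have eq: "(deriv ^^ (m + 2)) (\<lambda>t. ln (Re (mgamma (Suc m) (complex_of_real t)))) x =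
     - Re ((deriv ^^ (m + 2)) (wlog m) (of_real (x - 1)))" by simp
  have "x - 1 > -1" using x by simp
  then obtain s where s: "s \<ge> 0" "x - 1 > 0 \<Longrightarrow> s \<le> 1 / (x - 1)"
    "(deriv ^^ (m + 2)) (wlog m) (complex_of_real (x - 1)) = of_real ((-1) ^ (m + 1) * fact (m + 1) * s)"
    by (rule higher_deriv_wlog[where m = m]) blast
  have "(-1) ^ (m + 2) * (- ((-1) ^ (m + 1) * fact (m + 1) * s)) = fact (m + 1) * (s::real)"
    by (simp flip: power_add power_mult_distrib mult.assoc)
  hence "(-1) ^ (m + 2) * (deriv ^^ (m + 2)) (\<lambda>t. ln (Re (mgamma (Suc m) (complex_of_real t)))) x = fact (m + 1) * s"
    unfolding eq s(3) Re_complex_of_real .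
  with s(1,2) show ?thesis by (intro that[of s]) auto
qed

lemma mgamma_family: "multiple_Gamma_family mgamma"
  unfolding multiple_Gamma_family_def
proof (intro conjI allI impI)
  fix n :: nat and x :: real
  assume n: "1 \<le> n" and x: "x > 0"
  obtain m where n': "n = Suc m" using n by (cases n) auto
  obtain s where "s \<ge> 0"
    "(-1) ^ (m + 2) * (deriv ^^ (m + 2)) (\<lambda>t. ln (Re (mgamma (Suc m) (complex_of_real t)))) x = fact (m + 1) * s"
    using higher_deriv_ln_mgamma[OF x, of m] by metis
  thus "(- 1) ^ (n + 1) * (deriv ^^ (n + 1)) (\<lambda>t. ln (Re (mgamma n (complex_of_real t)))) x \<ge> 0"
    unfolding n' by (simp del: funpow.simps power_Suc)
qed (use mgamma_1 mgamma_nicely_meromorphic mgamma_at_1 mgamma_functional_equation mgamma_real_pos in auto)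

section \<open>Uniqueness of the family\<close>

lemma family_functional_equation_real:
  assumes G: "multiple_Gamma_family G" and n: "n \<ge> 1" and x: "x > 0"
  shows "Re (G (n + 1) (of_real (x + 1))) = Re (G (n + 1) (of_real x)) / Re (G n (of_real x))"
proof -
  have nice: "G k nicely_meromorphic_on UNIV" if "k \<ge> 1" for k
    using G that by (simp add: multiple_Gamma_family_def)
  have pos: "G k (of_real y) \<in> \<real>" "Re (G k (of_real y)) > 0" if "k \<ge> 1" "y > 0" for k y
    using G that by (auto simp: multiple_Gamma_family_def)
  have tendsto: "G k \<midarrow>complex_of_real y\<rightarrow> G k (of_real y)" if "k \<ge> 1" "y > 0" for k y
  proof -
    have "G k (of_real y) \<noteq> 0" using pos(2)[OF that] by auto
    thus ?thesis using nicely_meromorphic_on_tendsto[OF nice[OF that(1)]] by simp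
  qed
  \<comment> \<open>Both sides of the functional equation are continuous at \<open>x\<close>, so the
    identity on a punctured neighbourhood extends to \<open>x\<close> itself.\<close>
  have "G (n + 1) \<midarrow>complex_of_real x + 1\<rightarrow> G (n + 1) (of_real x + 1)"
    using tendsto[of "n + 1" "x + 1"] x by simp
  hence 1: "(\<lambda>z. G (n + 1) (z + 1)) \<midarrow>complex_of_real x\<rightarrow> G (n + 1) (of_real x + 1)"
    using LIM_offset[of "G (n + 1)" _ "of_real x + 1" 1] by simp
  have "G n (of_real x) \<noteq> 0" using pos(2)[OF n x] by auto
  hence 2: "(\<lambda>z. G (n + 1) z / G n z) \<midarrow>complex_of_real x\<rightarrow> G (n + 1) (of_real x) / G n (of_real x)"
    using x n by (intro tendsto_divide tendsto) auto
  have "\<forall>\<^sub>\<approx>z. G (n + 1) (z + 1) = G (n + 1) z / G n z"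
    using G n by (simp add: multiple_Gamma_family_def)
  hence "eventually (\<lambda>z. G (n + 1) (z + 1) = G (n + 1) z / G n z) (at (complex_of_real x))"
    by (rule eventually_cosparse_imp_eventually_at) auto
  with 1 have "(\<lambda>z. G (n + 1) z / G n z) \<midarrow>complex_of_real x\<rightarrow> G (n + 1) (of_real x + 1)"
    by (rule Lim_transform_eventually)
  from LIM_unique[OF this 2]
  have eq: "G (n + 1) (of_real (x + 1)) = G (n + 1) (of_real x) / G n (of_real x)" by simp
  have "G (n + 1) (of_real x) = of_real (Re (G (n + 1) (of_real x)))" "G n (of_real x) = of_real (Re (G n (of_real x)))"
    using pos x n by auto
  hence "G (n + 1) (of_real x) / G n (of_real x) = of_real (Re (G (n + 1) (of_real x)) / Re (G n (of_real x)))"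
    by (metis of_real_divide)
  thus ?thesis unfolding eq by (metis Re_complex_of_real)
qed

text \<open>Poles are shared, and both functions are 0 there; elsewhere each value is the limit of
  nearby common values.\<close>

lemma nicely_meromorphic_eqI_cosparse:
  assumes "f nicely_meromorphic_on UNIV" "g nicely_meromorphic_on UNIV"
    and "\<forall>\<^sub>\<approx>z. f z = g z"
  shows "f = g"
proof
  fix z
  have ev: "eventually (\<lambda>w. f w = g w) (at z)"
    by (rule eventually_cosparse_imp_eventually_at[OF assms(3)]) simp
  have pole: "is_pole f z \<longleftrightarrow> is_pole g z"
    by (rule is_pole_cong[OF ev refl])
  show "f z = g z"
  proof (cases "is_pole f z")
    case True
    have "\<not> h \<midarrow>z\<rightarrow> h z" if "is_pole h z" for h :: "complex \<Rightarrow> complex"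
      using that not_tendsto_and_filterlim_at_infinity[of "at z" h "h z"] by (auto simp: is_pole_def)
    with True pole assms(1,2) have "f z = 0" "g z = 0"
      unfolding nicely_meromorphic_on_def by blast+
    thus ?thesis by simp
  next
    case False
    with pole assms(1,2) have "f \<midarrow>z\<rightarrow> f z" "g \<midarrow>z\<rightarrow> g z"
      unfolding nicely_meromorphic_on_def by blast+
    with ev have "g \<midarrow>z\<rightarrow> f z" by (blast intro: Lim_transform_eventually)
    thus ?thesis using LIM_unique \<open>g \<midarrow>z\<rightarrow> g z\<close> by blast
  qed
qed

text \<open>Two meromorphic functions agree off a sparse set or differ off a sparse set; agreement
  on the reals near 1 excludes the latter.\<close>

lemma nicely_meromorphic_eqI_pos_reals:
  assumes "f nicely_meromorphic_on UNIV" "g nicely_meromorphic_on UNIV"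
    and eq: "\<And>x. x > 0 \<Longrightarrow> f (complex_of_real x) = g (of_real x)"
  shows "f = g"
proof (rule nicely_meromorphic_eqI_cosparse[OF assms(1,2)])
  have "f meromorphic_on UNIV" "g meromorphic_on UNIV"
    using assms by (auto simp: nicely_meromorphic_on_def)
  hence "(\<lambda>z. f z - g z) meromorphic_on UNIV" by (intro meromorphic_intros)
  from meromorphic_imp_constant_or_avoid[OF this, of 0]
  have "(\<forall>\<^sub>\<approx>z. f z = g z) \<or> (\<forall>\<^sub>\<approx>z. f z \<noteq> g z)"
    by (simp add: connected_UNIV)
  moreover have "\<not> (\<forall>\<^sub>\<approx>z. f z \<noteq> g z)"
  proof
    assume "\<forall>\<^sub>\<approx>z. f z \<noteq> g z"
    hence "eventually (\<lambda>z. f z \<noteq> g z) (at 1)"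
      by (rule eventually_cosparse_imp_eventually_at) simp
    then obtain d where d: "d > 0" "\<And>z. z \<noteq> 1 \<Longrightarrow> dist z 1 < d \<Longrightarrow> f z \<noteq> g z"
      unfolding eventually_at by auto
    have "complex_of_real (1 + d / 2) \<noteq> 1" "dist (complex_of_real (1 + d / 2)) 1 < d"
      using d(1) by (simp_all add: dist_norm)
    from d(2)[OF this] show False using eq[of "1 + d / 2"] d(1) by simp
  qed
  ultimately show "\<forall>\<^sub>\<approx>z. f z = g z" by blast
qed

text \<open>Induction on the index: the function at \<open>m + 1\<close> fixes the differences of
  the logarithm at \<open>m + 2\<close>. By \<open>difference_equation_unique\<close> this logarithm
  is determined up to a constant, which the value at 1 fixes.\<close>

lemma family_unique:
  assumes G: "multiple_Gamma_family G"
  shows "G (Suc m) = mgamma (Suc m)"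
proof (induction m)
  case 0
  have "G 1 = Gamma" using G by (simp add: multiple_Gamma_family_def)
  thus ?case using mgamma_1 by simp
next
  case (Suc m)
  define f where "f = (\<lambda>G t. ln (Re (G (Suc (Suc m)) (complex_of_real t))) :: real)"
  have pos: "F (Suc k) (of_real y) \<in> \<real>" "Re (F (Suc k) (of_real y)) > 0"
    if "multiple_Gamma_family F" "y > 0" for F k y
    using that by (auto simp: multiple_Gamma_family_def)
  have nice: "F (Suc k) nicely_meromorphic_on UNIV" if "multiple_Gamma_family F" for F k
    using that by (simp add: multiple_Gamma_family_def)
  have smooth: "((deriv ^^ j) (f F) has_real_derivative (deriv ^^ Suc j) (f F) x) (at x)"
    if "multiple_Gamma_family F" "x > 0" for F j x
    unfolding f_def
    by (rule nicely_meromorphic_ln_smooth[OF nice]) (use that pos in auto)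
  have diff: "f F (x + 1) - f F x = - ln (Re (F (Suc m) (of_real x)))"
    if "multiple_Gamma_family F" "x > 0" for F x
  proof -
    have "Re (F (Suc (Suc m)) (of_real (x + 1))) =
        Re (F (Suc (Suc m)) (of_real x)) / Re (F (Suc m) (of_real x))"
      using family_functional_equation_real[OF that(1), of "Suc m"] that(2) by simp
    thus ?thesis unfolding f_def using pos(2)[OF that, of m] pos(2)[OF that, of "Suc m"] by (simp add: ln_div)
  qed
  have at_1: "f F 1 = 0" if "multiple_Gamma_family F" for F
    using that by (simp add: f_def multiple_Gamma_family_def)
  have eq: "f G x = f mgamma x" if x: "x > 0" for x
  proof -
    have "f G x - f mgamma x = f G 1 - f mgamma 1"
    \<comment> \<open>At index \<open>m + 2\<close> the sign condition concerns the derivative of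
      order \<open>m + 3 = Suc N\<close>.\<close>
    proof (rule difference_equation_unique[where \<sigma> = "(-1) ^ (m + 3)" and N = "m + 2"])
      fix x :: real assume x: "x > 0"
      show "f G (x + 1) - f G x = f mgamma (x + 1) - f mgamma x"
        using diff[OF G x] diff[OF mgamma_family x] Suc.IH by simp
      have "\<forall>n\<ge>1. \<forall>x>0. (-1) ^ (n + 1) * (deriv ^^ (n + 1)) (\<lambda>t. ln (Re (G n (complex_of_real t)))) x \<ge> 0"
        using G by (simp add: multiple_Gamma_family_def)
      from this[rule_format, of "Suc (Suc m)" x] x
      show "0 \<le> (-1) ^ (m + 3) * (deriv ^^ Suc (m + 2)) (f G) x"
        by (simp add: f_def numeral_3_eq_3 del: funpow.simps power_Suc)
      show "(\<lambda>n. (-1) ^ (m + 3) * (deriv ^^ Suc (m + 2)) (f mgamma) (x + real n)) \<longlonglongrightarrow> 0"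
      proof (rule Lim_null_comparison)
        \<comment> \<open>From \<open>n = 1\<close> on, the argument exceeds 1, where the decay
          bound is available.\<close>
        show "\<forall>\<^sub>F n in sequentially. norm ((-1) ^ (m + 3) * (deriv ^^ Suc (m + 2)) (f mgamma) (x + real n))
               \<le> fact (m + 2) * (1 / (x + real n - 1))"
          using eventually_ge_at_top[of 1]
        proof eventually_elim
          case (elim n)
          hence "x + real n > 0" "x + real n > 1" using x by auto
          then obtain s where s: "s \<ge> 0" "s \<le> 1 / (x + real n - 1)"
            "(-1) ^ (Suc m + 2) * (deriv ^^ (Suc m + 2)) (f mgamma) (x + real n) = fact (Suc m + 1) * s"
            using higher_deriv_ln_mgamma[of "x + real n" "Suc m"] unfolding f_def by metis
          have "(-1) ^ (m + 3) * (deriv ^^ Suc (m + 2)) (f mgamma) (x + real n) = fact (m + 2) * s"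
            using s(3) by (simp add: numeral_3_eq_3 del: funpow.simps power_Suc fact_Suc)
          moreover have "fact (m + 2) * s \<le> fact (m + 2) * (1 / (x + real n - 1))"
            using s(2) by (rule mult_left_mono) simp
          moreover have "norm (fact (m + 2) * s) = fact (m + 2) * s"
            using s(1) by simp
          ultimately show ?case by (simp only:)
        qed
        show "(\<lambda>n. fact (m + 2) * (1 / (x + real n - 1))) \<longlonglongrightarrow> 0" by real_asymp
      qed
    qed (use smooth G mgamma_family x in auto)
    thus ?thesis using at_1 G mgamma_family by simp
  qed
  show ?case
  proof (rule nicely_meromorphic_eqI_pos_reals[OF nice[OF G] nice[OF mgamma_family]])
    fix x :: real assume x: "x > 0"
    have "Re (G (Suc (Suc m)) (of_real x)) = Re (mgamma (Suc (Suc m)) (of_real x))"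
      using eq[OF x] pos(2)[OF G x, of "Suc m"] pos(2)[OF mgamma_family x, of "Suc m"]
      by (simp add: f_def)
    thus "G (Suc (Suc m)) (of_real x) = mgamma (Suc (Suc m)) (of_real x)"
      using pos(1)[OF G x, of "Suc m"] pos(1)[OF mgamma_family x, of "Suc m"]
      by (metis of_real_Re)
  qed
qed

lemma multiple_Gamma_eq_mgamma: "multiple_Gamma (Suc m) = mgamma (Suc m)"
  unfolding multiple_Gamma_def
proof (rule the_equality)
  show "\<exists>G. multiple_Gamma_family G \<and> mgamma (Suc m) = G (Suc m)"
    using mgamma_family by blast
  fix f assume "\<exists>G. multiple_Gamma_family G \<and> f = G (Suc m)"
  then obtain G where "multiple_Gamma_family G" "f = G (Suc m)" by blast
  with family_unique show "f = mgamma (Suc m)" by metis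
qed

subsection \<open>The product formula\<close>

text \<open>Expanding by coefficients leaves power sums only; those of order 0 agree because both
  families share the index set.\<close>

lemma sum_poly_eq_of_power_sums_eq:
  fixes a b :: "'i \<Rightarrow> 'a::comm_ring_1"
  assumes "degree p \<le> n"
    and "\<And>j. j \<in> {1..n} \<Longrightarrow> (\<Sum>l\<in>I. a l ^ j) = (\<Sum>l\<in>I. b l ^ j)"
  shows "(\<Sum>l\<in>I. poly p (a l)) = (\<Sum>l\<in>I. poly p (b l))"
proof -
  have expand: "(\<Sum>l\<in>I. poly p (c l)) = (\<Sum>j\<le>degree p. coeff p j * (\<Sum>l\<in>I. c l ^ j))" for c :: "'i \<Rightarrow> 'a"
    unfolding poly_altdef sum_distrib_left by (rule sum.swap)
  have "(\<Sum>l\<in>I. a l ^ j) = (\<Sum>l\<in>I. b l ^ j)" if "j \<le> degree p" for j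
    using assms that by (cases "j = 0") auto
  thus ?thesis unfolding expand by simp
qed

theorem theorem4p1:
  fixes n i :: nat and a b :: "nat \<Rightarrow> complex"
  assumes "n \<ge> 1"
    and "\<And>k. k \<in> {1..i} \<Longrightarrow> a k \<notin> complex_of_int ` {..<0}"
    and "\<And>k. k \<in> {1..i} \<Longrightarrow> b k \<notin> complex_of_int ` {..<0}"
    and "\<And>j. j \<in> {1..n} \<Longrightarrow> (\<Sum>k=1..i. a k ^ j) = (\<Sum>k=1..i. b k ^ j)"
  shows "(\<lambda>N. \<Prod>k=1..N.
            ((\<Prod>l=1..i. of_nat k + a l) / (\<Prod>l=1..i. of_nat k + b l)) ^ ((n + k - 2) choose (n - 1)))
         \<longlonglongrightarrow> (\<Prod>l=1..i. multiple_Gamma n (b l + 1)) / (\<Prod>l=1..i. multiple_Gamma n (a l + 1))"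
proof -
  obtain m where n: "n = Suc m" using assms(1) by (cases n) auto
  define I where "I = {1..i}"
  have eq_sum: "(\<Sum>l\<in>I. poly p (a l)) = (\<Sum>l\<in>I. poly p (b l))" if "degree p \<le> Suc m" for p
    by (rule sum_poly_eq_of_power_sums_eq[OF that]) (use assms(4) in \<open>simp add: I_def n\<close>)
  \<comment> \<open>The zeros of \<open>wprod m\<close> are these negative integers, so the limit of
    the denominators will be nonzero.\<close>
  have not_neg: "b l \<noteq> - of_nat (Suc k)" if "l \<in> I" for l k
  proof
    assume "b l = - of_nat (Suc k)"
    hence "b l = complex_of_int (- int (Suc k))" by simp
    moreover have "- int (Suc k) \<in> {..<0}" by simp
    ultimately show False using assms(3)[of l] that by (simp only: I_def) blast
  qed
  have factor: "((\<Prod>l\<in>I. of_nat (Suc k) + a l) / (\<Prod>l\<in>I. of_nat (Suc k) + b l)) ^ ((m + k) choose m)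
      = (\<Prod>l\<in>I. gfac m k (a l)) / (\<Prod>l\<in>I. gfac m k (b l))" for k
  proof -
    define K where "K = (of_nat (Suc k) :: complex)"
    have K: "K \<noteq> 0" unfolding K_def using of_nat_neq_0 by blast
    have prod_gfac: "(\<Prod>l\<in>I. gfac m k (c l)) =
       ((\<Prod>l\<in>I. K + c l) * (exp (\<Sum>l\<in>I. poly (wpoly m (1 / K)) (c l)) / K ^ card I)) ^ ((m + k) choose m)"
      for c :: "nat \<Rightarrow> complex"
    proof -
      have "1 + c l / K = (K + c l) / K" for l using K by (simp add: field_simps)
      hence "gfac m k (c l) = ((K + c l) / K * exp (poly (wpoly m (1 / K)) (c l))) ^ ((m + k) choose m)" for l
        unfolding gfac_def K_def[symmetric] poly_wpoly by simp
      thus ?thesis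
        by (simp add: prod_power_distrib[symmetric] prod.distrib prod_dividef exp_sum I_def)
    qed
    \<comment> \<open>Shared by \<open>a\<close> and \<open>b\<close>:
      \<open>wpoly m (1 / K)\<close> has degree at most \<open>m + 1\<close>, and both products have
      \<open>card I\<close> factors.\<close>
    define E where "E = exp (\<Sum>l\<in>I. poly (wpoly m (1 / K)) (b l)) / K ^ card I"
    have "E \<noteq> 0" using K by (simp add: E_def)
    have "(\<Prod>l\<in>I. gfac m k (a l)) / (\<Prod>l\<in>I. gfac m k (b l)) =
      ((\<Prod>l\<in>I. K + a l) * E / ((\<Prod>l\<in>I. K + b l) * E)) ^ ((m + k) choose m)"
      unfolding prod_gfac eq_sum[OF degree_wpoly] E_def[symmetric] by (rule power_divide[symmetric])
    thus ?thesis using \<open>E \<noteq> 0\<close> by (simp add: K_def)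
  qed
  have partial: "(\<Prod>k=1..N. ((\<Prod>l=1..i. of_nat k + a l) / (\<Prod>l=1..i. of_nat k + b l)) ^ ((n + k - 2) choose (n - 1)))
      = (\<Prod>l\<in>I. \<Prod>k<N. gfac m k (a l)) / (\<Prod>l\<in>I. \<Prod>k<N. gfac m k (b l))" for N
  proof -
    \<comment> \<open>With \<open>n = m + 1\<close> and \<open>k\<close> replaced by
      \<open>Suc k\<close>, the exponent becomes \<open>(m + k) choose m\<close>.\<close>
    have "(\<Prod>k=1..N. ((\<Prod>l=1..i. of_nat k + a l) / (\<Prod>l=1..i. of_nat k + b l)) ^ ((n + k - 2) choose (n - 1)))
       = (\<Prod>k<N. ((\<Prod>l\<in>I. of_nat (Suc k) + a l) / (\<Prod>l\<in>I. of_nat (Suc k) + b l)) ^ ((m + k) choose m))"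
      by (rule prod.reindex_bij_witness[of _ Suc "\<lambda>k. k - 1"]) (auto simp: n I_def)
    also have "\<dots> = (\<Prod>k<N. (\<Prod>l\<in>I. gfac m k (a l)) / (\<Prod>l\<in>I. gfac m k (b l)))"
      by (simp only: factor)
    finally show ?thesis
      by (simp only: prod_dividef prod.swap[of _ "{..<N}" I])
  qed
  have "(\<lambda>N. (\<Prod>l\<in>I. \<Prod>k<N. gfac m k (a l)) / (\<Prod>l\<in>I. \<Prod>k<N. gfac m k (b l)))
     \<longlonglongrightarrow> (\<Prod>l\<in>I. wprod m (a l)) / (\<Prod>l\<in>I. wprod m (b l))"
    using not_neg by (intro tendsto_divide tendsto_prod gfac_LIMSEQ) (auto simp: wprod_eq_0_iff I_def)
  moreover have "(\<Prod>l\<in>I. wprod m (a l)) / (\<Prod>l\<in>I. wprod m (b l)) =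
     (\<Prod>l\<in>I. multiple_Gamma n (b l + 1)) / (\<Prod>l\<in>I. multiple_Gamma n (a l + 1))"
  proof -
    \<comment> \<open>By \<open>eq_sum\<close> the exponential is the same for \<open>a\<close> and
      \<open>b\<close>; the inverse interchanges numerator and denominator.\<close>
    have "(\<Prod>l\<in>I. multiple_Gamma n (c l + 1)) =
       inverse (exp (\<Sum>l\<in>I. poly (cpoly m) (c l)) * (\<Prod>l\<in>I. wprod m (c l)))" for c :: "nat \<Rightarrow> complex"
    proof -
      have "(\<Prod>l\<in>I. multiple_Gamma n (c l + 1)) = (\<Prod>l\<in>I. inverse (rmgamma m (c l)))"
        by (simp add: n multiple_Gamma_eq_mgamma mgamma_def)
      also have "\<dots> = inverse (\<Prod>l\<in>I. rmgamma m (c l))"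
        using prod_inversef[of "\<lambda>l. rmgamma m (c l)" I] by (simp add: o_def)
      finally show ?thesis
        by (simp add: rmgamma_def prod.distrib exp_sum I_def)
    qed
    thus ?thesis by (simp add: eq_sum[OF degree_cpoly] divide_inverse)
  qed
  ultimately show ?thesis unfolding partial I_def by simp
qed

end
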